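(* Let $F_k$ denote the free group of rank $k$. If $n\ge 4$ then there is a Lipschitz retraction from $\mathsf{Out}(F_n)$ to a subgroup of $\mathsf{Out}(F_n)$ isomorphic to $\mathsf{Aut}(F_3)$, and there is a Lipschitz retraction from $\mathsf{Aut}(F_n)$ to a subgroup of $\mathsf{Aut}(F_n)$ isomorphic to $\mathsf{Aut}(F_3)$.
   Context: Finitely generated groups are equipped with the word metric of any finite generating set. For a finitely generated group $G$ and a finitely generated subgroup $H<G$, a Lipschitz retraction from $G$ to $H$ is a function $\pi\colon G\to H$ (not necessarily a homomorphism) that restricts to the identity on $H$ and for which there is a constant $K\ge 1$ such that $d_H(\pi(a),\pi(b))\le K\,d_G(a,b)$ for all $a,b\in G$. *)

theory Defs
  imports Complex_Main "HOL-Algebra.Bij" "HOL-Algebra.Coset" "HOL-Algebra.Generated_Groups"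
begin

section \<open>Free groups of finite rank\<close>

text \<open>
  The pair \<open>(i, True)\<close> stands for the basis element \<open>x\<^sub>i\<close> and \<open>(i, False)\<close> for its formal inverse.
  The free group of rank \<open>k\<close> consists of the reduced words in the letters with \<open>i < k\<close>.
\<close>

type_synonym fletter = "nat \<times> bool"

definition flip :: "fletter \<Rightarrow> fletter" where
  "flip a = (fst a, \<not> snd a)"

definition reduced_word :: "fletter list \<Rightarrow> bool" where
  "reduced_word w \<longleftrightarrow> successively (\<lambda>a b. b \<noteq> flip a) w"

fun reduce_cons :: "fletter \<Rightarrow> fletter list \<Rightarrow> fletter list" where
  "reduce_cons a [] = [a]"
| "reduce_cons a (b # w) = (if b = flip a then w else a # b # w)"

definition free_group :: "nat \<Rightarrow> fletter list monoid" where
  "free_group k =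
    \<lparr>carrier = {w. reduced_word w \<and> fst ` set w \<subseteq> {..<k}},
     mult = (\<lambda>u v. foldr reduce_cons u v),
     one = []\<rparr>"

lemma flip_flip [simp]: "flip (flip a) = a"
  by (simp add: flip_def)

lemma fst_flip [simp]: "fst (flip a) = fst a"
  by (simp add: flip_def)

lemma flip_neq [simp]: "flip a \<noteq> a" "a \<noteq> flip a"
  by (auto simp: flip_def prod_eq_iff)

lemma reduced_word_simps [simp]:
  "reduced_word []" "reduced_word [a]"
  "reduced_word (a # b # w) \<longleftrightarrow> b \<noteq> flip a \<and> reduced_word (b # w)"
  by (simp_all add: reduced_word_def)

lemma reduced_word_tl: "reduced_word (a # w) \<Longrightarrow> reduced_word w"
  by (cases w) auto

lemma reduced_reduce_cons: "reduced_word w \<Longrightarrow> reduced_word (reduce_cons a w)"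
  by (cases w) (auto dest: reduced_word_tl)

lemma reduced_foldr: "reduced_word w \<Longrightarrow> reduced_word (foldr reduce_cons u w)"
  by (induction u) (auto intro: reduced_reduce_cons)

lemma reduce_cons_flip:
  assumes "reduced_word w" shows "reduce_cons a (reduce_cons (flip a) w) = w"
proof (cases w)
  case (Cons b w')
  then show ?thesis using assms by (cases w') auto
qed simp

lemma foldr_reduce_cons:
  "reduced_word w \<Longrightarrow> foldr reduce_cons (reduce_cons a v) w = reduce_cons a (foldr reduce_cons v w)"
proof (cases v)
  case (Cons b v')
  assume w: "reduced_word w"
  show ?thesis
  proof (cases "b = flip a")
    case True
    then show ?thesis
      by (simp add: Cons reduce_cons_flip[OF reduced_foldr[OF w]])
  qed (simp add: Cons)
qed simp

lemma foldr_reduce_assoc: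
  "reduced_word w \<Longrightarrow>
    foldr reduce_cons (foldr reduce_cons u v) w = foldr reduce_cons u (foldr reduce_cons v w)"
  by (induction u) (auto simp: foldr_reduce_cons)

lemma foldr_reduced: "reduced_word w \<Longrightarrow> foldr reduce_cons w [] = w"
proof (induction w)
  case (Cons a w)
  then show ?case by (cases w) (auto dest: reduced_word_tl)
qed simp

lemma set_reduce_cons: "set (reduce_cons a w) \<subseteq> insert a (set w)"
  by (cases w) auto

lemma set_foldr_reduce: "set (foldr reduce_cons u v) \<subseteq> set u \<union> set v"
  by (induction u) (use set_reduce_cons in fastforce)+

lemma foldr_flip:
  "reduced_word w \<Longrightarrow> foldr reduce_cons (rev (map flip u)) (foldr reduce_cons u w) = w"
proof (induction u arbitrary: w)
  case (Cons a u)
  have "reduce_cons (flip a) (reduce_cons a (foldr reduce_cons u w)) = foldr reduce_cons u w"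
    using reduce_cons_flip[OF reduced_foldr[OF Cons.prems], of "flip a" u] by simp
  then show ?case using Cons by simp
qed simp

lemma reduced_inverse: "reduced_word w \<Longrightarrow> reduced_word (rev (map flip w))"
  unfolding reduced_word_def successively_rev successively_map
  by (erule successively_mono) auto

lemma group_free_group: "group (free_group k)"
proof (rule groupI)
  fix x y assume xy: "x \<in> carrier (free_group k)" "y \<in> carrier (free_group k)"
  have "fst ` set (foldr reduce_cons x y) \<subseteq> fst ` set x \<union> fst ` set y"
    using image_mono[OF set_foldr_reduce[of x y], of fst] by (simp only: image_Un)
  also have "\<dots> \<subseteq> {..<k}" using xy by (simp add: free_group_def)
  finally show "x \<otimes>\<^bsub>free_group k\<^esub> y \<in> carrier (free_group k)"
    using xy by (simp add: free_group_def reduced_foldr)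
next
  fix x y z assume "z \<in> carrier (free_group k)"
  then show "x \<otimes>\<^bsub>free_group k\<^esub> y \<otimes>\<^bsub>free_group k\<^esub> z =
      x \<otimes>\<^bsub>free_group k\<^esub> (y \<otimes>\<^bsub>free_group k\<^esub> z)"
    by (simp add: free_group_def foldr_reduce_assoc)
next
  fix x assume x: "x \<in> carrier (free_group k)"
  have "rev (map flip x) \<in> carrier (free_group k)"
    using x by (simp add: free_group_def reduced_inverse image_image)
  moreover have "foldr reduce_cons (rev (map flip x)) x = []"
    using foldr_flip[of "[]" x] foldr_reduced[of x] x by (simp add: free_group_def)
  ultimately show "\<exists>y\<in>carrier (free_group k). y \<otimes>\<^bsub>free_group k\<^esub> x = \<one>\<^bsub>free_group k\<^esub>"
    by (intro bexI[of _ "rev (map flip x)"]) (simp_all add: free_group_def)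
qed (simp_all add: free_group_def)

definition letter_value :: "('a, 'b) monoid_scheme \<Rightarrow> (nat \<Rightarrow> 'a) \<Rightarrow> fletter \<Rightarrow> 'a" where
  "letter_value G f a = (if snd a then f (fst a) else inv\<^bsub>G\<^esub> f (fst a))"

definition word_value :: "('a, 'b) monoid_scheme \<Rightarrow> (nat \<Rightarrow> 'a) \<Rightarrow> fletter list \<Rightarrow> 'a" where
  "word_value G f w = foldr (\<lambda>a y. letter_value G f a \<otimes>\<^bsub>G\<^esub> y) w \<one>\<^bsub>G\<^esub>"

lemma word_value_simps [simp]:
  "word_value G f [] = \<one>\<^bsub>G\<^esub>"
  "word_value G f (a # w) = letter_value G f a \<otimes>\<^bsub>G\<^esub> word_value G f w"
  by (simp_all add: word_value_def)

context group begin

lemma letter_value_closed: "f (fst a) \<in> carrier G \<Longrightarrow> letter_value G f a \<in> carrier G"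
  by (simp add: letter_value_def)

lemma letter_value_flip:
  "f (fst a) \<in> carrier G \<Longrightarrow> letter_value G f (flip a) = inv (letter_value G f a)"
  by (simp add: letter_value_def flip_def)

lemma word_value_closed: "f ` fst ` set w \<subseteq> carrier G \<Longrightarrow> word_value G f w \<in> carrier G"
  by (induction w) (auto intro: letter_value_closed)

lemma word_value_reduce_cons:
  assumes "f (fst a) \<in> carrier G" "f ` fst ` set w \<subseteq> carrier G"
  shows "word_value G f (reduce_cons a w) = letter_value G f a \<otimes> word_value G f w"
proof (cases w)
  case (Cons b w')
  then show ?thesis
    using assms word_value_closed[of f w'] letter_value_closed[of f a] inv_solve_left
    by (auto simp: letter_value_flip m_assoc [symmetric])
qed (use assms in simp)

lemma word_value_foldr:
  assumes "f ` fst ` set u \<subseteq> carrier G" "f ` fst ` set v \<subseteq> carrier G"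
  shows "word_value G f (foldr reduce_cons u v) = word_value G f u \<otimes> word_value G f v"
  using assms(1)
proof (induction u)
  case Nil
  then show ?case using assms(2) by (simp add: word_value_closed)
next
  case (Cons a u)
  have "f ` fst ` set (foldr reduce_cons u v) \<subseteq> carrier G"
    using set_foldr_reduce[of u v] Cons.prems assms(2) by (auto simp: image_subset_iff)
  then show ?case
    using Cons assms(2)
    by (simp add: word_value_reduce_cons m_assoc word_value_closed letter_value_closed)
qed

lemma word_value_hom:
  assumes "f ` {..<k} \<subseteq> carrier G" shows "word_value G f \<in> hom (free_group k) G"
proof -
  have "f ` fst ` set w \<subseteq> carrier G" if "w \<in> carrier (free_group k)" for w
    using that assms by (force simp: free_group_def)
  then show ?thesis
    by (auto simp: hom_def word_value_closed free_group_def word_value_foldr)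
qed

end

lemma free_group_hom_eq_word_value:
  assumes G: "group G" and h: "h \<in> hom (free_group k) G"
    and f: "\<And>i. i < k \<Longrightarrow> h [(i, True)] = f i"
    and w: "w \<in> carrier (free_group k)"
  shows "h w = word_value G f w"
proof -
  interpret F: group "free_group k" by (rule group_free_group)
  interpret H: group_hom "free_group k" G h
    using G h by (simp add: group_hom_def group_hom_axioms_def F.is_group)
  have letter: "[a] \<in> carrier (free_group k)" if "fst a < k" for a
    using that by (simp add: free_group_def)
  have val: "h [a] = letter_value G f a" if a: "fst a < k" for a
  proof (cases "snd a")
    case True
    then show ?thesis using a f by (cases a) (simp add: letter_value_def)
  next
    case False
    then obtain i where i: "a = (i, False)" "i < k" using a by (cases a) auto
    have "[a] \<otimes>\<^bsub>free_group k\<^esub> [(i, True)] = \<one>\<^bsub>free_group k\<^esub>"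
      using i by (simp add: free_group_def flip_def)
    then have "[a] = inv\<^bsub>free_group k\<^esub> [(i, True)]"
      using i letter[of a] letter[of "(i, True)"] by (simp add: F.inv_equality)
    then show ?thesis
      using i f[of i] letter[of "(i, True)"] H.hom_inv by (simp add: letter_value_def)
  qed
  show ?thesis using w
  proof (induction w)
    case Nil
    then show ?case using H.hom_one by (simp add: free_group_def)
  next
    case (Cons a w)
    have a: "fst a < k" and w: "w \<in> carrier (free_group k)"
      using Cons.prems by (auto simp: free_group_def dest: reduced_word_tl)
    have "a # w = [a] \<otimes>\<^bsub>free_group k\<^esub> w"
      using Cons.prems by (cases w) (auto simp: free_group_def)
    then have "h (a # w) = h [a] \<otimes>\<^bsub>G\<^esub> h w"
      using H.hom_mult[OF letter[OF a] w] by simp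
    then show ?case using Cons.IH[OF w] val[OF a] by simp
  qed
qed

theorem free_group_universal:
  fixes G :: "('a, 'b) monoid_scheme"
  assumes "group G" "f ` {..<k} \<subseteq> carrier G"
  shows "\<exists>!h. h \<in> hom (free_group k) G \<inter> extensional (carrier (free_group k)) \<and>
              (\<forall>i<k. h [(i, True)] = f i)"
proof -
  let ?h = "restrict (word_value G f) (carrier (free_group k))"
  interpret group G by fact
  interpret F: group "free_group k" by (rule group_free_group)
  have "?h \<in> hom (free_group k) G"
    using word_value_hom[OF assms(2)] by (auto simp: hom_def)
  moreover have "?h [(i, True)] = f i" if "i < k" for i
    using that assms(2) by (auto simp: free_group_def letter_value_def image_subset_iff)
  moreover have "h = ?h" if "h \<in> hom (free_group k) G \<inter> extensional (carrier (free_group k))"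
      and "\<forall>i<k. h [(i, True)] = f i" for h
    using that free_group_hom_eq_word_value[OF assms(1), of h k f]
    by (intro extensionalityI[of _ "carrier (free_group k)"]) auto
  ultimately show ?thesis by (intro ex1I[of _ ?h]) auto
qed


section \<open>Inner and outer automorphisms\<close>

definition Inn :: "('a, 'b) monoid_scheme \<Rightarrow> ('a \<Rightarrow> 'a) set" where
  "Inn G = (\<lambda>g. \<lambda>x \<in> carrier G. g \<otimes>\<^bsub>G\<^esub> x \<otimes>\<^bsub>G\<^esub> inv\<^bsub>G\<^esub> g) ` carrier G"

definition OutGroup :: "('a, 'b) monoid_scheme \<Rightarrow> ('a \<Rightarrow> 'a) set monoid" where
  "OutGroup G = AutoGroup G Mod Inn G"


section \<open>Word metrics and Lipschitz retractions\<close>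

definition finite_generating_set :: "('a, 'b) monoid_scheme \<Rightarrow> 'a set \<Rightarrow> bool" where
  "finite_generating_set G S \<longleftrightarrow> finite S \<and> S \<subseteq> carrier G \<and> generate G S = carrier G"

definition finitely_generated :: "('a, 'b) monoid_scheme \<Rightarrow> bool" where
  "finitely_generated G \<longleftrightarrow> (\<exists>S. finite_generating_set G S)"

definition word_length :: "('a, 'b) monoid_scheme \<Rightarrow> 'a set \<Rightarrow> 'a \<Rightarrow> nat" where
  "word_length G S g =
    (LEAST n. \<exists>ws. length ws = n \<and> set ws \<subseteq> S \<union> m_inv G ` S \<and> g = foldr (mult G) ws \<one>\<^bsub>G\<^esub>)"

definition word_dist :: "('a, 'b) monoid_scheme \<Rightarrow> 'a set \<Rightarrow> 'a \<Rightarrow> 'a \<Rightarrow> nat" where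
  "word_dist G S a b = word_length G S (inv\<^bsub>G\<^esub> a \<otimes>\<^bsub>G\<^esub> b)"

text \<open>
  Word metrics for different finite generating sets are bi-Lipschitz equivalent, so the choice
  is immaterial; the definition asks for a constant for every choice, and that there is a choice.
\<close>

definition lipschitz_retraction ::
    "('a, 'b) monoid_scheme \<Rightarrow> 'a set \<Rightarrow> ('a \<Rightarrow> 'a) \<Rightarrow> bool" where
  "lipschitz_retraction G H \<pi> \<longleftrightarrow>
    group G \<and> subgroup H G \<and>
    finitely_generated G \<and> finitely_generated (G\<lparr>carrier := H\<rparr>) \<and>
    \<pi> \<in> carrier G \<rightarrow> H \<and> (\<forall>h\<in>H. \<pi> h = h) \<and>
    (\<forall>S T. finite_generating_set G S \<longrightarrow> finite_generating_set (G\<lparr>carrier := H\<rparr>) T \<longrightarrow>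
      (\<exists>K::real. K \<ge> 1 \<and> (\<forall>a\<in>carrier G. \<forall>b\<in>carrier G.
        real (word_dist (G\<lparr>carrier := H\<rparr>) T (\<pi> a) (\<pi> b)) \<le> K * real (word_dist G S a b))))"

context group begin

lemma cancel:
  "\<lbrakk>g \<in> carrier G; x \<in> carrier G\<rbrakk> \<Longrightarrow> inv g \<otimes> (g \<otimes> x) = x"
  "\<lbrakk>g \<in> carrier G; x \<in> carrier G\<rbrakk> \<Longrightarrow> g \<otimes> (inv g \<otimes> x) = x"
  by (simp_all flip: m_assoc)

lemma conj_in_auto:
  assumes g: "g \<in> carrier G" shows "(\<lambda>x \<in> carrier G. g \<otimes> x \<otimes> inv g) \<in> auto G"
proof -
  have "bij_betw (\<lambda>x. g \<otimes> x \<otimes> inv g) (carrier G) (carrier G)"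
    by (rule bij_betw_byWitness[where f' = "\<lambda>x. inv g \<otimes> x \<otimes> g"])
       (use g in \<open>auto simp: m_assoc cancel\<close>)
  moreover have "g \<otimes> (x \<otimes> y) \<otimes> inv g = (g \<otimes> x \<otimes> inv g) \<otimes> (g \<otimes> y \<otimes> inv g)"
    if "x \<in> carrier G" "y \<in> carrier G" for x y
    using g that by (simp add: m_assoc cancel)
  ultimately show ?thesis
    using g by (auto simp: auto_def Bij_def hom_def bij_betw_restrict_eq)
qed

lemma AutoGroup_simps:
  "carrier (AutoGroup G) = auto G"
  "\<one>\<^bsub>AutoGroup G\<^esub> = (\<lambda>x \<in> carrier G. x)"
  "\<lbrakk>f \<in> auto G; h \<in> auto G\<rbrakk> \<Longrightarrow> f \<otimes>\<^bsub>AutoGroup G\<^esub> h = compose (carrier G) f h"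
  by (auto simp: AutoGroup_def BijGroup_def auto_def)

lemma conj_hom_AutoGroup:
  "(\<lambda>g. \<lambda>x \<in> carrier G. g \<otimes> x \<otimes> inv g) \<in> hom G (AutoGroup G)"
proof (rule homI)
  fix g h assume gh: "g \<in> carrier G" "h \<in> carrier G"
  show "(\<lambda>x \<in> carrier G. g \<otimes> h \<otimes> x \<otimes> inv (g \<otimes> h)) =
      (\<lambda>x \<in> carrier G. g \<otimes> x \<otimes> inv g) \<otimes>\<^bsub>AutoGroup G\<^esub> (\<lambda>x \<in> carrier G. h \<otimes> x \<otimes> inv h)"
    unfolding AutoGroup_simps(3)[OF conj_in_auto[OF gh(1)] conj_in_auto[OF gh(2)]]
    using gh by (auto simp: compose_def inv_mult_group m_assoc)
qed (simp add: AutoGroup_simps conj_in_auto)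

lemma Inn_normal: "Inn G \<lhd> AutoGroup G"
proof -
  interpret A: group "AutoGroup G" by (rule AutoGroup)
  interpret c: group_hom G "AutoGroup G" "\<lambda>g. \<lambda>x \<in> carrier G. g \<otimes> x \<otimes> inv g"
    by (simp add: group_hom_def group_hom_axioms_def conj_hom_AutoGroup A.is_group is_group)
  show ?thesis unfolding A.normal_inv_iff
  proof (intro conjI ballI)
    show "subgroup (Inn G) (AutoGroup G)"
      unfolding Inn_def by (rule c.img_is_subgroup)
  next
    fix f h assume f: "f \<in> carrier (AutoGroup G)" and "h \<in> Inn G"
    then obtain g where g: "g \<in> carrier G"
      and h: "h = (\<lambda>x \<in> carrier G. g \<otimes> x \<otimes> inv g)" by (auto simp: Inn_def)
    have fa: "f \<in> auto G" using f by (simp add: AutoGroup_simps)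
    interpret f: group_hom G G f
      using fa by (simp add: auto_def group_hom_def group_hom_axioms_def is_group)
    let ?h = "\<lambda>x \<in> carrier G. f g \<otimes> x \<otimes> inv (f g)"
    have ha: "h \<in> auto G" "?h \<in> auto G" using conj_in_auto g h by auto
    have "f \<otimes>\<^bsub>AutoGroup G\<^esub> h = ?h \<otimes>\<^bsub>AutoGroup G\<^esub> f"
      using g h fa ha by (auto intro!: ext simp: AutoGroup_simps compose_def)
    then have "f \<otimes>\<^bsub>AutoGroup G\<^esub> h \<otimes>\<^bsub>AutoGroup G\<^esub> inv\<^bsub>AutoGroup G\<^esub> f = ?h"
      using f ha by (simp add: A.m_assoc AutoGroup_simps(1)[symmetric])
    then show "f \<otimes>\<^bsub>AutoGroup G\<^esub> h \<otimes>\<^bsub>AutoGroup G\<^esub> inv\<^bsub>AutoGroup G\<^esub> f \<in> Inn G"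
      using g by (auto simp: Inn_def)
  qed
qed

lemma group_OutGroup: "group (OutGroup G)"
  unfolding OutGroup_def by (rule normal.factorgroup_is_group[OF Inn_normal])

lemma generate_word:
  assumes "S \<subseteq> carrier G" "g \<in> generate G S"
  shows "\<exists>ws. set ws \<subseteq> S \<union> m_inv G ` S \<and> g = foldr (mult G) ws \<one>"
  using assms(2)
proof (induction rule: generate.induct)
  case one
  show ?case by (rule exI[of _ "[]"]) simp
next
  case (incl h)
  then show ?case using assms(1) by (intro exI[of _ "[h]"]) auto
next
  case (inv h)
  then show ?case using assms(1) by (intro exI[of _ "[inv h]"]) auto
next
  case (eng h1 h2)
  then obtain us vs where u: "set us \<subseteq> S \<union> m_inv G ` S" "h1 = foldr (mult G) us \<one>"
    and v: "set vs \<subseteq> S \<union> m_inv G ` S" "h2 = foldr (mult G) vs \<one>" by auto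
  have cl: "S \<union> m_inv G ` S \<subseteq> carrier G" using assms(1) by auto
  have closed: "foldr (mult G) ws \<one> \<in> carrier G" if "set ws \<subseteq> carrier G" for ws
    using that by (induction ws) auto
  have vs: "foldr (mult G) vs \<one> \<in> carrier G" using v(1) cl by (intro closed) blast
  have "foldr (mult G) ws (foldr (mult G) vs \<one>) = foldr (mult G) ws \<one> \<otimes> foldr (mult G) vs \<one>"
    if "set ws \<subseteq> carrier G" for ws
    using that
  proof (induction ws)
    case (Cons a ws)
    then show ?case using closed vs by (simp add: m_assoc)
  qed (use vs in simp)
  then have "foldr (mult G) (us @ vs) \<one> = h1 \<otimes> h2" 
    using u v(2) cl by (metis dual_order.trans foldr_append comp_apply)
  then show ?case using u v by (intro exI[of _ "us @ vs"]) auto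
qed

lemma word_length_attained:
  assumes "finite_generating_set G S" "g \<in> carrier G"
  shows "\<exists>ws. length ws = word_length G S g \<and> set ws \<subseteq> S \<union> m_inv G ` S \<and>
              g = foldr (mult G) ws \<one>"
proof -
  obtain ws where "set ws \<subseteq> S \<union> m_inv G ` S" "g = foldr (mult G) ws \<one>"
    using generate_word[of S g] assms by (auto simp: finite_generating_set_def)
  then show ?thesis
    unfolding word_length_def by (intro LeastI) auto
qed

end

end

theory Submission
  imports Defs
begin

text \<open>
  The argument works for \<open>Aut(F\<^sub>k)\<close> with \<open>0 < k < n\<close>. Let \<open>A =
  F\<^sub>k\<close> be the free factor of \<open>F\<^sub>n\<close> on the first \<open>k\<close> basis elements and
  \<open>x\<close> the basis element after them; \<open>Aut(A)\<close> sits in \<open>Aut(F\<^sub>n)\<close> and in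
  \<open>Out(F\<^sub>n)\<close> as the automorphisms that fix the remaining basis elements
  (\<open>extend_auto\<close>).

  An automorphism \<open>a\<close> of \<open>F\<^sub>n\<close> is a change of marking: \<open>F\<^sub>n\<close>
  acts on its Cayley tree, \<open>g\<close> by left multiplication with \<open>a\<^sup>-\<^sup>1(g)\<close>. The
  quotient of the tree by \<open>A\<close> is a graph with fundamental group \<open>A\<close>, and the
  \<open>k\<close> edges outside a spanning tree, together with a base point, give a basis of \<open>A\<close>,
  that is an element of \<open>Aut(A)\<close>. This element is the value of the retraction at \<open>a\<close>. For
  another representative of the class of \<open>a\<close> in \<open>Out(F\<^sub>n)\<close> the tree is the same up
  to isomorphism, but its root has moved, so the root cannot be the base point. The boundary point
  \<open>x\<^sup>\<infinity>\<close> serves instead: it does not lie in the boundary of \<open>A\<close>, and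
  therefore all far vertices \<open>x\<^sup>m\<close>, and all vertices within bounded distance of them, are seen
  from \<open>A\<close> in the same way (\<open>dual_walls_shift\<close>).

  Graphs and spanning trees are avoided by half-spaces. An edge of the tree is recorded by the half-tree behind it,
  and a basis of \<open>A\<close> is dual to edges, seen from a vertex \<open>P\<close>, if for every letter
  \<open>c\<close> there is a half-tree that contains the translate of \<open>P\<close> by \<open>g\<close> exactly
  when the reduced word of \<open>g\<close> in this basis starts with \<open>c\<close> (\<open>dual_walls\<close>).
  The word length of \<open>g\<close> in the basis is then at most the number of translates of these edges that
  separate \<open>P\<close> from its translate.

  Dual edges exist by Nielsen's method. A basis of \<open>A\<close> that cannot be improved by Nielsen moves is
  Nielsen reduced (\<open>nielsen_reduction\<close>); then each basis word has a letter that no product cancels,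
  and the edge at this letter is dual to the basis element (\<open>nielsen_reduced_dual_walls\<close>). With
  \<open>A = F\<^sub>n\<close> the same two facts give a finite generating set of \<open>Aut(F\<^sub>n)\<close>.

  The retraction is Lipschitz because multiplying \<open>a\<close> by a fixed automorphism \<open>t\<close> from
  the right changes the dual basis by an automorphism from a finite set that depends only on \<open>t\<close>
  (\<open>dual_basis_change_bounded\<close>). Two facts bound the length of the new basis elements in the old
  basis. An edge of the old tree is crossed by boundedly many edges of the new tree, with a bound that depends on
  \<open>t\<close>. And in the new tree the path from \<open>P\<close> to its translate by a new basis element
  meets an \<open>A\<close>-orbit of oriented edges at most twice (\<open>coset_visits_le_2\<close>): on a part of
  the path that crosses no dual edge, a return to the same orbit would give an element of \<open>A\<close> of
  infinite order all of whose powers have bounded length.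

  On \<open>Aut(F\<^sub>n)\<close> the retraction is the one of \<open>Out(F\<^sub>n)\<close> after the quotient
  map.
\<close>

declare split_paired_All [simp del] split_paired_Ex [simp del]

section \<open>Reduced words as vertices of the Cayley tree\<close>

abbreviation F :: "nat \<Rightarrow> fletter list set" where
  "F n \<equiv> carrier (free_group n)"

definition wmult :: "fletter list \<Rightarrow> fletter list \<Rightarrow> fletter list" (infixr "\<cdot>" 70) where
  "u \<cdot> v = foldr reduce_cons u v"

definition winv :: "fletter list \<Rightarrow> fletter list" where
  "winv w = rev (map flip w)"

interpretation FG: group "free_group n" for n
  by (rule group_free_group)

lemma F_iff: "w \<in> F n \<longleftrightarrow> reduced_word w \<and> fst ` set w \<subseteq> {..<n}"
  by (simp add: free_group_def)

lemma mult_F [simp]: "u \<otimes>\<^bsub>free_group n\<^esub> v = u \<cdot> v"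
  by (simp add: free_group_def wmult_def)

lemma one_F [simp]: "\<one>\<^bsub>free_group n\<^esub> = []"
  by (simp add: free_group_def)

lemma F_reduced [dest]: "w \<in> F n \<Longrightarrow> reduced_word w"
  by (simp add: F_iff)

lemma F_Nil [simp]: "[] \<in> F n"
  by (simp add: F_iff)

lemma F_letter [simp]: "[a] \<in> F n \<longleftrightarrow> fst a < n"
  by (simp add: F_iff)

lemma F_mult [simp, intro]: "u \<in> F n \<Longrightarrow> v \<in> F n \<Longrightarrow> u \<cdot> v \<in> F n"
  using FG.m_closed[of u n v] by simp

lemma winv_simps [simp]:
  "winv [] = []" "winv [a] = [flip a]" "winv (winv w) = w"
  "length (winv w) = length w" "winv w = [] \<longleftrightarrow> w = []"
  "winv (u @ v) = winv v @ winv u" "winv (a # v) = winv v @ [flip a]"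
  by (auto simp: winv_def rev_map o_def)

lemma winv_reduced [simp]: "reduced_word (winv w) \<longleftrightarrow> reduced_word w"
  using reduced_inverse[of w] reduced_inverse[of "winv w"] by (auto simp: winv_def rev_map o_def)

lemma F_winv [simp, intro]: "w \<in> F n \<Longrightarrow> winv w \<in> F n"
  by (simp add: F_iff reduced_inverse) (auto simp: winv_def)

lemma mult_reduced [simp, intro]: "reduced_word v \<Longrightarrow> reduced_word (u \<cdot> v)"
  by (simp add: wmult_def reduced_foldr)

lemma Nil_mult [simp]: "[] \<cdot> w = w"
  by (simp add: wmult_def)

lemma mult_Nil [simp]: "reduced_word w \<Longrightarrow> w \<cdot> [] = w"
  by (simp add: wmult_def foldr_reduced)

lemma mult_assoc: "reduced_word w \<Longrightarrow> (u \<cdot> v) \<cdot> w = u \<cdot> (v \<cdot> w)"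
  by (simp add: wmult_def foldr_reduce_assoc)

lemma winv_mult_cancel [simp]:
  "reduced_word w \<Longrightarrow> winv u \<cdot> (u \<cdot> w) = w"
  "reduced_word w \<Longrightarrow> u \<cdot> (winv u \<cdot> w) = w"
  using foldr_flip[of w u] foldr_flip[of w "winv u"]
  by (auto simp: wmult_def winv_def rev_map o_def)

lemma winv_mult_self [simp]:
  "reduced_word w \<Longrightarrow> winv w \<cdot> w = []" "reduced_word w \<Longrightarrow> w \<cdot> winv w = []"
  using winv_mult_cancel[of "[]" w] winv_mult_cancel[of "[]" "winv w"] by auto

lemma inv_F [simp]: "w \<in> F n \<Longrightarrow> inv\<^bsub>free_group n\<^esub> w = winv w"
  by (rule FG.inv_equality) auto

lemma winv_mult: "reduced_word u \<Longrightarrow> reduced_word v \<Longrightarrow> winv (u \<cdot> v) = winv v \<cdot> winv u"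
proof -
  assume uv: "reduced_word u" "reduced_word v"
  have "winv (u \<cdot> v) = winv (u \<cdot> v) \<cdot> ((u \<cdot> v) \<cdot> (winv v \<cdot> winv u))"
    using uv by (simp add: mult_assoc)
  also have "\<dots> = winv v \<cdot> winv u"
    using uv by (subst winv_mult_cancel(1)) auto
  finally show ?thesis .
qed

lemma mult_left_cancel [simp]:
  "reduced_word v \<Longrightarrow> reduced_word w \<Longrightarrow> u \<cdot> v = u \<cdot> w \<longleftrightarrow> v = w"
  by (metis winv_mult_cancel(1))

lemma mult_right_cancel [simp]:
  assumes "reduced_word u" "reduced_word v" "reduced_word w"
  shows "v \<cdot> u = w \<cdot> u \<longleftrightarrow> v = w"
proof
  assume "v \<cdot> u = w \<cdot> u"
  then have "(v \<cdot> u) \<cdot> winv u = (w \<cdot> u) \<cdot> winv u" by simp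
  then show "v = w" using assms by (simp add: mult_assoc)
qed simp

lemma mult_append: "reduced_word (u @ v) \<Longrightarrow> u \<cdot> v = u @ v"
proof (induction u)
  case (Cons a u)
  then have "u \<cdot> v = u @ v" using reduced_word_tl by simp
  then show ?case using Cons.prems by (cases "u @ v") (auto simp: wmult_def)
qed simp

lemma reduced_append:
  "reduced_word (u @ v) \<longleftrightarrow>
    reduced_word u \<and> reduced_word v \<and> (u \<noteq> [] \<and> v \<noteq> [] \<longrightarrow> hd v \<noteq> flip (last u))"
  by (auto simp: reduced_word_def successively_append_iff)

lemma reduced_take [simp]: "reduced_word w \<Longrightarrow> reduced_word (take q w)"
  and reduced_drop [simp]: "reduced_word w \<Longrightarrow> reduced_word (drop q w)"
  using reduced_append[of "take q w" "drop q w"] by auto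

lemma F_take [simp]: "w \<in> F n \<Longrightarrow> take q w \<in> F n"
  and F_drop [simp]: "w \<in> F n \<Longrightarrow> drop q w \<in> F n"
  using set_take_subset[of q w] set_drop_subset[of q w] by (auto simp: F_iff)

lemma take_mult_drop: "reduced_word w \<Longrightarrow> take q w \<cdot> drop q w = w"
  by (simp add: mult_append)

lemma take_Suc_mult: "reduced_word w \<Longrightarrow> q < length w \<Longrightarrow> take (Suc q) w = take q w \<cdot> [w ! q]"
  by (metis take_Suc_conv_app_nth mult_append reduced_take)

definition starts :: "fletter \<Rightarrow> fletter list \<Rightarrow> bool" where
  "starts l w \<longleftrightarrow> w \<noteq> [] \<and> hd w = l"

lemma starts_simps [simp]:
  "\<not> starts l []" "starts l (a # w) \<longleftrightarrow> a = l"
  "starts l (u @ w) \<longleftrightarrow> (if u = [] then starts l w else starts l u)"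
  by (auto simp: starts_def)

lemma mult_letter_cases:
  assumes "reduced_word w"
  obtains w' where "w = w' @ [flip m]" "w \<cdot> [m] = w'" "reduced_word w'"
  | "w \<cdot> [m] = w @ [m]"
proof (cases "w \<noteq> [] \<and> last w = flip m")
  case True
  then have w: "w = butlast w @ [flip m]" by (metis append_butlast_last_id)
  then have red: "reduced_word (butlast w)" "reduced_word (butlast w @ [flip m])"
    using assms reduced_append[of "butlast w" "[flip m]"] by auto
  have "w \<cdot> [m] = (butlast w \<cdot> [flip m]) \<cdot> [m]"
    using w red(2) by (simp add: mult_append)
  also have "\<dots> = butlast w \<cdot> ([flip m] \<cdot> [m])" by (simp add: mult_assoc)
  also have "\<dots> = butlast w" using red winv_mult_self(1)[of "[m]"] by simp
  finally show ?thesis using that(1) w red by blast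
next
  case False
  then have "reduced_word (w @ [m])" using assms by (auto simp: reduced_append)
  then show ?thesis using that(2) by (simp add: mult_append)
qed

lemma starts_mult_letter:
  assumes "reduced_word w" "starts l w \<noteq> starts l (w \<cdot> [m])"
  shows "w = [] \<and> m = l \<or> w = [l] \<and> m = flip l"
  using assms(1)
proof (cases rule: mult_letter_cases[of w m])
  case (1 w')
  then show ?thesis using assms(2) by (cases "w' = []") (auto split: if_splits)
next
  case 2
  then show ?thesis using assms(2) by (auto split: if_splits)
qed

lemma crosses_into:
  assumes "reduced_word w" "\<not> starts l w" "starts l (w \<cdot> [m])"
  shows "w = []" "m = l"
  using starts_mult_letter[of w l m] assms by auto

text \<open>
  A vertex \<open>u\<close> and a word \<open>p\<close> span the path \<open>u \<cdot> take q p\<close>; a set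
  entered by the end of the path is entered at some edge.
\<close>

lemma path_enters:
  assumes "reduced_word p" "reduced_word u" "\<not> Z u" "Z (u \<cdot> p)"
  obtains q where "q < length p" "\<not> Z (u \<cdot> take q p)" "Z (u \<cdot> take q p \<cdot> [p ! q])"
proof -
  have "\<exists>q<length p. (\<forall>i\<le>q. \<not> Z (u \<cdot> take i p)) \<and> Z (u \<cdot> take (q + 1) p)"
    using assms ex_least_nat_less[where P = "\<lambda>i. Z (u \<cdot> take i p)" and n = "length p"] by auto
  then show ?thesis using that assms(1) take_Suc_mult by fastforce
qed

text \<open>
  The half of the tree that lies behind the edge from the vertex \<open>v\<close> in direction \<open>l\<close>.
\<close>

definition half_space :: "fletter list \<Rightarrow> fletter \<Rightarrow> fletter list set" where
  "half_space v l = {u. starts l (winv v \<cdot> u)}"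

lemma half_space_translate:
  "reduced_word x \<Longrightarrow> reduced_word v \<Longrightarrow> reduced_word u \<Longrightarrow>
    u \<in> half_space (x \<cdot> v) l \<longleftrightarrow> winv x \<cdot> u \<in> half_space v l"
  by (simp add: half_space_def winv_mult mult_assoc)

lemma enters_half_space:
  assumes "reduced_word u" "reduced_word v" "u \<notin> half_space v l" "u \<cdot> [m] \<in> half_space v l"
  shows "u = v" "m = l"
proof -
  have eq: "(winv v \<cdot> u) \<cdot> [m] = winv v \<cdot> (u \<cdot> [m])" by (simp add: mult_assoc)
  have "winv v \<cdot> u = []" "m = l"
    using crosses_into[of "winv v \<cdot> u" l m] assms unfolding eq by (auto simp: half_space_def)
  then show "u = v" "m = l"
    using assms by (metis mult_Nil winv_mult_cancel(2))+
qed

text \<open>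
  The edge that bounds a half-tree lies on every path between the two sides. If the path leaves the half-tree, it
  meets the far end of this edge first and the vertex \<open>v\<close> last, so that \<open>q\<close> can be the
  full length of \<open>p\<close>.
\<close>

lemma wall_on_path:
  assumes "reduced_word p" "reduced_word u" "reduced_word v"
    and sep: "(u \<in> half_space v l) \<noteq> (u \<cdot> p \<in> half_space v l)"
  obtains q where "q \<le> length p" "v = u \<cdot> take q p"
proof -
  define Z where "Z x \<longleftrightarrow> (x \<in> half_space v l) \<noteq> (u \<in> half_space v l)" for x
  obtain q where q: "q < length p" "\<not> Z (u \<cdot> take q p)" "Z (u \<cdot> take q p \<cdot> [p ! q])"
    using path_enters[of p u Z] assms by (auto simp: Z_def)
  let ?w = "winv v \<cdot> u \<cdot> take q p"
  have w: "reduced_word ?w" using assms by simp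
  have "?w \<cdot> [p ! q] = winv v \<cdot> u \<cdot> take q p \<cdot> [p ! q]" by (simp add: mult_assoc)
  then have "starts l ?w \<noteq> starts l (?w \<cdot> [p ! q])" using q by (auto simp: Z_def half_space_def)
  from starts_mult_letter[OF w this] show ?thesis
  proof
    assume "?w = [] \<and> p ! q = l"
    then have "v = u \<cdot> take q p"
      using assms(1-3) by (metis mult_Nil winv_mult_cancel(2) mult_reduced reduced_take)
    then show ?thesis using q by (intro that[of q]) auto
  next
    assume a: "?w = [l] \<and> p ! q = flip l"
    then have "?w \<cdot> [p ! q] = []" using winv_mult_self(1)[of "[flip l]"] by simp
    then have "winv v \<cdot> u \<cdot> take (Suc q) p = []"
      using q assms by (simp add: take_Suc_mult mult_assoc)
    then have "v = u \<cdot> take (Suc q) p"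
      using assms by (metis mult_Nil winv_mult_cancel(2) mult_reduced reduced_take)
    then show ?thesis using q that[of "Suc q"] by simp
  qed
qed

section \<open>Common prefixes and cancellation\<close>

fun lcp_length :: "'a list \<Rightarrow> 'a list \<Rightarrow> nat" where
  "lcp_length (a # u) (b # v) = (if a = b then Suc (lcp_length u v) else 0)"
| "lcp_length _ _ = 0"

lemma lcp_length_commute: "lcp_length u v = lcp_length v u"
  by (induction u v rule: lcp_length.induct) auto

lemma lcp_length_le: "lcp_length u v \<le> length u" "lcp_length u v \<le> length v"
  by (induction u v rule: lcp_length.induct) auto

lemma take_lcp_length: "take (lcp_length u v) u = take (lcp_length u v) v"
  by (induction u v rule: lcp_length.induct) auto

lemma lcp_length_geI: "take j u = take j v \<Longrightarrow> j \<le> length u \<Longrightarrow> j \<le> length v \<Longrightarrow> j \<le> lcp_length u v"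
proof (induction u v arbitrary: j rule: lcp_length.induct)
  case (1 a u b v)
  then show ?case by (cases j) auto
qed auto

lemma lcp_length_eqI:
  "take j v = take j d \<Longrightarrow> lcp_length u d < j \<Longrightarrow> j \<le> length d \<Longrightarrow> lcp_length u v = lcp_length u d"
proof (induction u arbitrary: d v j)
  case (Cons a u)
  obtain i b d' where d: "j = Suc i" "d = b # d'" using Cons.prems by (cases j; cases d) auto
  then obtain v' where v: "v = b # v'" using Cons.prems(1) by (cases v) auto
  show ?case
  proof (cases "a = b")
    case True
    then have "lcp_length u v' = lcp_length u d'" using Cons.prems d v by (intro Cons.IH[of i]) auto
    then show ?thesis using d v True by simp
  qed (simp add: d v)
qed simp

lemma append_mult: "(u @ v) \<cdot> w = u \<cdot> (v \<cdot> w)"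
  by (simp add: wmult_def)

lemma winv_mult_lcp:
  "reduced_word u \<Longrightarrow> reduced_word v \<Longrightarrow>
    winv u \<cdot> v = winv (drop (lcp_length u v) u) @ drop (lcp_length u v) v"
proof (induction u v rule: lcp_length.induct)
  case (1 a u b v)
  show ?case
  proof (cases "a = b")
    case True
    have "[flip a] \<cdot> (a # v) = v" by (simp add: wmult_def)
    then show ?thesis using 1 True by (auto simp: append_mult dest: reduced_word_tl)
  next
    case False
    have "last (winv (a # u)) = flip a" by simp
    then have "reduced_word (winv (a # u) @ b # v)"
      unfolding reduced_append winv_reduced using 1(2,3) False by (simp del: winv_simps)
    then show ?thesis using mult_append[of "winv (a # u)" "b # v"] False by simp
  qed
next
  case ("2_2" u)
  then show ?case by (auto simp del: winv_simps)
qed auto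

lemma length_winv_mult:
  "reduced_word u \<Longrightarrow> reduced_word v \<Longrightarrow>
    length (winv u \<cdot> v) + 2 * lcp_length u v = length u + length v"
  using lcp_length_le[of u v] by (simp add: winv_mult_lcp)

lemma winv_drop: "winv (drop j w) = take (length w - j) (winv w)"
  by (simp add: winv_def drop_map rev_drop take_map rev_map)

text \<open>
  A word and its inverse cannot agree on half of their length: at the middle a letter would be its own inverse, or
  two adjacent letters would cancel.
\<close>

lemma lcp_length_winv:
  assumes w: "reduced_word w" "w \<noteq> []"
  shows "2 * lcp_length w (winv w) < length w"
proof (rule ccontr)
  assume "\<not> ?thesis"
  then have c: "length w \<le> 2 * lcp_length w (winv w)" by simp
  have eq: "w ! i = flip (w ! (length w - 1 - i))" if "i < lcp_length w (winv w)" for i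
  proof -
    have "w ! i = winv w ! i"
      using take_lcp_length[of w "winv w"] that by (metis nth_take)
    also have "\<dots> = flip (w ! (length w - 1 - i))"
      using that lcp_length_le[of w "winv w"] by (simp add: winv_def rev_nth)
    finally show ?thesis .
  qed
  show False
  proof (cases "even (length w)")
    case True
    then obtain h' where h': "length w = 2 * h'" by (rule evenE)
    then obtain h where "h' = Suc h" using w by (cases h') auto
    then have h: "length w = 2 * Suc h" using h' by simp
    have "w ! h = flip (w ! Suc h)" using eq[of h] c h by simp
    moreover have "w ! Suc h \<noteq> flip (w ! h)"
      using w(1) h unfolding reduced_word_def successively_conv_nth by simp
    ultimately show False by simp
  next
    case False
    then obtain h where h: "length w = 2 * h + 1" by (rule oddE)
    have "w ! h = flip (w ! h)" using eq[of h] c h by simp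
    then show False by (metis flip_neq(1))
  qed
qed

text \<open>
  For an edge that points away from the root \<open>[]\<close>, cancellation with \<open>v\<close> stops before the
  end of \<open>v\<close> unless \<open>v\<close> is a prefix.
\<close>

lemma in_half_space_iff:
  assumes "reduced_word (v @ [l])" "reduced_word w"
  shows "starts l (winv v \<cdot> w) \<longleftrightarrow> take (Suc (length v)) w = v @ [l]"
proof -
  have v: "reduced_word v" using assms by (simp add: reduced_append)
  note eq = winv_mult_lcp[OF v assms(2)]
  show ?thesis
  proof (cases "lcp_length v w = length v")
    case True
    then have "take (length v) w = v" using take_lcp_length[of v w] by simp
    then obtain w' where "w = v @ w'" by (metis append_take_drop_id)
    then show ?thesis using eq True by (cases w') auto
  next
    case False
    have "\<not> take (Suc (length v)) w = v @ [l]"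
    proof
      assume "take (Suc (length v)) w = v @ [l]"
      then obtain w' where "w = v @ l # w'"
        by (metis append_take_drop_id append.assoc append_Cons append_Nil)
      then have "length v \<le> lcp_length v w" by (intro lcp_length_geI) auto
      then show False using False lcp_length_le(1)[of v w] by simp
    qed
    moreover have "drop (lcp_length v w) v \<noteq> []" using False lcp_length_le(1)[of v w] by simp
    then have "starts l (winv v \<cdot> w) \<longleftrightarrow> flip (last v) = l"
      unfolding eq by (auto simp: starts_def winv_def hd_rev last_map)
    moreover have "flip (last v) \<noteq> l"
      using assms(1) False lcp_length_le(1)[of v w] by (auto simp: reduced_append)
    ultimately show ?thesis by simp
  qed
qed


section \<open>Nielsen reduced embeddings have dual walls\<close>

definition free_embedding :: "nat \<Rightarrow> nat \<Rightarrow> (fletter list \<Rightarrow> fletter list) \<Rightarrow> bool" where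
  "free_embedding k n b \<longleftrightarrow> b \<in> hom (free_group k) (free_group n) \<and> inj_on b (F k)"

lemma free_embeddingD:
  assumes "free_embedding k n b"
  shows free_embedding_closed: "u \<in> F k \<Longrightarrow> b u \<in> F n"
    and free_embedding_mult: "u \<in> F k \<Longrightarrow> v \<in> F k \<Longrightarrow> b (u \<cdot> v) = b u \<cdot> b v"
    and free_embedding_Nil: "b [] = []"
    and free_embedding_winv: "u \<in> F k \<Longrightarrow> b (winv u) = winv (b u)"
    and free_embedding_eq_iff: "u \<in> F k \<Longrightarrow> v \<in> F k \<Longrightarrow> b u = b v \<longleftrightarrow> u = v"
    and free_embedding_eq_Nil_iff: "u \<in> F k \<Longrightarrow> b u = [] \<longleftrightarrow> u = []"
proof -
  interpret h: group_hom "free_group k" "free_group n" b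
    using assms by unfold_locales (simp add: free_embedding_def)
  show closed: "u \<in> F k \<Longrightarrow> b u \<in> F n" for u by (rule h.hom_closed)
  show "u \<in> F k \<Longrightarrow> v \<in> F k \<Longrightarrow> b (u \<cdot> v) = b u \<cdot> b v" using h.hom_mult by simp
  show "b [] = []" using h.hom_one by simp
  then show "u \<in> F k \<Longrightarrow> b u = [] \<longleftrightarrow> u = []"
    using assms unfolding free_embedding_def by (metis F_Nil inj_on_eq_iff)
  show "u \<in> F k \<Longrightarrow> b (winv u) = winv (b u)" using h.hom_inv closed by (metis inv_F)
  show "u \<in> F k \<Longrightarrow> v \<in> F k \<Longrightarrow> b u = b v \<longleftrightarrow> u = v"
    using assms by (auto simp: free_embedding_def inj_on_eq_iff)
qed

text \<open>
  In a reduced product of letters \<open>flip c\<close>, \<open>d\<close>, \<open>e\<close> the image of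
  \<open>d\<close> loses a prefix to its left and a suffix to its right neighbour. The condition says that these
  two parts never cover the image of \<open>d\<close>.
\<close>

definition nielsen_reduced :: "nat \<Rightarrow> (fletter list \<Rightarrow> fletter list) \<Rightarrow> bool" where
  "nielsen_reduced k b \<longleftrightarrow>
    (\<forall>c d e. fst c < k \<and> fst d < k \<and> fst e < k \<and> c \<noteq> d \<and> e \<noteq> flip d \<longrightarrow>
      lcp_length (b [c]) (b [d]) + lcp_length (b [flip d]) (b [e]) < length (b [d]))"

text \<open>
  Seen from \<open>P\<close>, the translates of \<open>P\<close> lie in the half-trees in the pattern of the tree
  of the free group of rank \<open>k\<close>. The letters \<open>c\<close> include the inverses of the basis
  elements; the edges found for \<open>c\<close> and for \<open>flip c\<close> are in general different, since a
  basis word may have several letters that never cancel.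
\<close>

definition dual_walls ::
    "nat \<Rightarrow> nat \<Rightarrow> (fletter list \<Rightarrow> fletter list) \<Rightarrow> fletter list \<Rightarrow> bool" where
  "dual_walls k n b P \<longleftrightarrow>
    (\<forall>c. fst c < k \<longrightarrow> (\<exists>v\<in>F n. \<exists>l. \<forall>g\<in>F k. b g \<cdot> P \<in> half_space v l \<longleftrightarrow> starts c g))"

lemma F_Cons: "c # g \<in> F k \<longleftrightarrow> fst c < k \<and> g \<in> F k \<and> \<not> starts (flip c) g"
  using reduced_append[of "[c]" g] by (auto simp: F_iff starts_def)

text \<open>
  The number \<open>j\<close> counts the letters of \<open>b [c]\<close> that survive in \<open>b (c # g)\<close>.
  They reach beyond the point where the image of any other letter \<open>f\<close> branches off, so the
  cancellation between \<open>b [c]\<close> and what precedes it is the one between the two letters, and the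
  induction continues.
\<close>

lemma nielsen_reduced_prefix:
  assumes b: "free_embedding k n b" and N: "nielsen_reduced k b" and g: "c # g \<in> F k"
  shows "\<exists>j\<le>length (b [c]). take j (b (c # g)) = take j (b [c]) \<and>
    (\<forall>f. fst f < k \<and> f \<noteq> c \<longrightarrow> lcp_length (b [f]) (b [c]) < j)"
  using g
proof (induction g arbitrary: c)
  case Nil
  have "lcp_length (b [f]) (b [c]) < length (b [c])" if "fst f < k" "f \<noteq> c" for f
  proof -
    have "fst c < k" "c \<noteq> flip c" using Nil by (auto simp: F_Cons)
    then show ?thesis
      using N[unfolded nielsen_reduced_def, rule_format, of f c c] that by simp
  qed
  then show ?case by blast
next
  case (Cons d g)
  have cd: "fst c < k" "fst d < k" "d \<noteq> flip c" "d # g \<in> F k" and c: "[c] \<in> F k"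
    using Cons.prems by (auto simp: F_Cons)
  obtain j where j: "j \<le> length (b [d])" "take j (b (d # g)) = take j (b [d])"
    and "\<forall>f. fst f < k \<and> f \<noteq> d \<longrightarrow> lcp_length (b [f]) (b [d]) < j"
    using Cons.IH[OF cd(4)] by blast
  then have "lcp_length (b [flip c]) (b [d]) < j" using cd by auto
  define m where "m = lcp_length (b [flip c]) (b [d])"
  then have m: "lcp_length (b [flip c]) (b (d # g)) = m"
    using j \<open>lcp_length (b [flip c]) (b [d]) < j\<close> lcp_length_eqI[of j] by simp
  have inv: "winv (b [flip c]) = b [c]"
    using free_embedding_winv[OF b, of "[c]"] c by simp
  have len: "length (b [flip c]) = length (b [c])"
    using inv by (metis winv_simps(4))
  have red: "reduced_word (b [flip c])" "reduced_word (b (d # g))"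
    using free_embedding_closed[OF b, of "[flip c]"] free_embedding_closed[OF b cd(4)] cd by auto
  have "b (c # d # g) = b [c] \<cdot> b (d # g)"
    using free_embedding_mult[OF b c cd(4)] mult_append[of "[c]" "d # g"] Cons.prems by auto
  also have "\<dots> = winv (drop m (b [flip c])) @ drop m (b (d # g))"
    using winv_mult_lcp[OF red] by (simp add: inv m)
  also have "\<dots> = take (length (b [c]) - m) (b [c]) @ drop m (b (d # g))"
    by (simp add: winv_drop inv len)
  finally have eq: "b (c # d # g) = take (length (b [c]) - m) (b [c]) @ drop m (b (d # g))" .
  have "lcp_length (b [f]) (b [c]) < length (b [c]) - m" if "fst f < k" "f \<noteq> c" for f
    using N[unfolded nielsen_reduced_def, rule_format, of f c d] that cd by (simp add: m_def)
  then show ?case by (intro exI[of _ "length (b [c]) - m"]) (simp add: eq)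
qed

text \<open>
  The dual edge of \<open>c\<close> is the first edge of the path to \<open>b [c]\<close> that is not shared with
  the path to the image of another letter.
\<close>

theorem nielsen_reduced_dual_walls:
  assumes b: "free_embedding k n b" and N: "nielsen_reduced k b"
  shows "dual_walls k n b []"
  unfolding dual_walls_def
proof (intro allI impI)
  fix c :: fletter assume c: "fst c < k"
  define L where "L = Max ((\<lambda>f. lcp_length (b [f]) (b [c])) ` {f. fst f < k \<and> f \<noteq> c})"
  have "finite {f :: fletter. fst f < k \<and> f \<noteq> c}"
    by (rule finite_subset[of _ "{..<k} \<times> UNIV"]) auto
  then have fin: "finite ((\<lambda>f. lcp_length (b [f]) (b [c])) ` {f. fst f < k \<and> f \<noteq> c})" by simp
  have L_ge: "lcp_length (b [f]) (b [c]) \<le> L" if "fst f < k" "f \<noteq> c" for f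
    unfolding L_def using fin that by (intro Max_ge) auto
  have "L \<in> (\<lambda>f. lcp_length (b [f]) (b [c])) ` {f. fst f < k \<and> f \<noteq> c}"
    unfolding L_def
  proof (rule Max_in[OF fin])
    have "flip c \<in> {f. fst f < k \<and> f \<noteq> c}" using c by simp
    then show "(\<lambda>f. lcp_length (b [f]) (b [c])) ` {f. fst f < k \<and> f \<noteq> c} \<noteq> {}" by blast
  qed
  then obtain f0 where f0: "fst f0 < k" "f0 \<noteq> c" "L = lcp_length (b [f0]) (b [c])" by auto
  have bc: "b [c] \<in> F n" using free_embedding_closed[OF b] c by simp
  have L_less: "L < length (b [c])"
  proof -
    obtain j where "j \<le> length (b [c])" "\<forall>f. fst f < k \<and> f \<noteq> c \<longrightarrow> lcp_length (b [f]) (b [c]) < j"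
      using nielsen_reduced_prefix[OF b N, of c "[]"] c by auto
    then show ?thesis using f0 by (metis less_le_trans)
  qed
  define v where "v = take L (b [c])"
  define l where "l = b [c] ! L"
  have vl: "v @ [l] = take (Suc L) (b [c])" and lv: "length v = L"
    using L_less by (simp_all add: v_def l_def take_Suc_conv_app_nth)
  have "starts l (winv v \<cdot> b g \<cdot> []) \<longleftrightarrow> starts c g" if g: "g \<in> F k" for g
  proof -
    have bg: "reduced_word (b g)" using free_embedding_closed[OF b g] by auto
    then have "starts l (winv v \<cdot> b g \<cdot> []) \<longleftrightarrow> take (Suc L) (b g) = take (Suc L) (b [c])"
      using in_half_space_iff[of v l "b g"] bc by (auto simp: vl lv)
    also have "\<dots> \<longleftrightarrow> starts c g"
    proof (cases g)
      case Nil
      then show ?thesis using L_less free_embedding_Nil[OF b] by (cases "b [c]") auto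
    next
      case (Cons d g')
      obtain j where j: "j \<le> length (b [d])" "take j (b g) = take j (b [d])"
        "\<And>f. fst f < k \<Longrightarrow> f \<noteq> d \<Longrightarrow> lcp_length (b [f]) (b [d]) < j"
        using nielsen_reduced_prefix[OF b N, of d g'] g Cons by blast
      show ?thesis
      proof (cases "d = c")
        case True
        then have "Suc L \<le> j" using j(3)[of f0] f0 by simp
        then have "take (Suc L) (b g) = take (Suc L) (b [c])"
          using j(2) True by (metis min.absorb1 take_take)
        then show ?thesis using Cons True by simp
      next
        case False
        have d: "fst d < k" using g Cons by (simp add: F_Cons)
        have "lcp_length (b [c]) (b g) = lcp_length (b [c]) (b [d])"
          using j(1,2) j(3)[of c] c False by (intro lcp_length_eqI[of j]) auto
        also have "\<dots> \<le> L" using L_ge[of d] d False by (simp add: lcp_length_commute)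
        finally have le: "lcp_length (b [c]) (b g) \<le> L" .
        have "take (Suc L) (b g) \<noteq> take (Suc L) (b [c])"
        proof
          assume eq: "take (Suc L) (b g) = take (Suc L) (b [c])"
          then have "length (take (Suc L) (b g)) = Suc L" using L_less by simp
          then have "Suc L \<le> length (b g)" by simp
          then have "Suc L \<le> lcp_length (b [c]) (b g)"
            using eq L_less by (intro lcp_length_geI) auto
          then show False using le by simp
        qed
        then show ?thesis using Cons False by simp
      qed
    qed
    finally show ?thesis .
  qed
  moreover have "v \<in> F n" using bc by (simp add: v_def)
  ultimately show "\<exists>v\<in>F n. \<exists>l. \<forall>g\<in>F k. b g \<cdot> [] \<in> half_space v l \<longleftrightarrow> starts c g"
    unfolding half_space_def mem_Collect_eq by blast
qed

section \<open>Nielsen moves\<close>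

definition extend :: "nat \<Rightarrow> nat \<Rightarrow> (nat \<Rightarrow> fletter list) \<Rightarrow> fletter list \<Rightarrow> fletter list" where
  "extend k n f = restrict (word_value (free_group n) f) (F k)"

lemma extend_hom:
  "(\<And>i. i < k \<Longrightarrow> f i \<in> F n) \<Longrightarrow> extend k n f \<in> hom (free_group k) (free_group n)"
  using FG.word_value_hom[of f k n] by (auto simp: extend_def hom_def image_subset_iff)

lemma extend_extensional: "extend k n f \<in> extensional (F k)"
  by (simp add: extend_def)

lemma extend_letter:
  assumes "i < k" "f i \<in> F n"
  shows "extend k n f [(i, True)] = f i"
  using assms by (auto simp: extend_def letter_value_def)

lemma hom_eq_on_F:
  assumes "h \<in> hom (free_group k) (free_group n)" "h' \<in> hom (free_group k) (free_group n)"
    and "\<And>i. i < k \<Longrightarrow> h [(i, True)] = h' [(i, True)]" "w \<in> F k"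
  shows "h w = h' w"
  using free_group_hom_eq_word_value[OF group_free_group assms(1) assms(3) assms(4)]
    free_group_hom_eq_word_value[OF group_free_group assms(2) refl assms(4)] by simp

lemma auto_F_iff:
  "s \<in> auto (free_group k) \<longleftrightarrow> free_embedding k k s \<and> s ` F k = F k \<and> s \<in> extensional (F k)"
  by (auto simp: auto_def Bij_def bij_betw_def free_embedding_def)

lemma auto_FI:
  assumes s: "s \<in> hom (free_group k) (free_group k)" "s \<in> extensional (F k)"
    and t: "t \<in> hom (free_group k) (free_group k)"
    and st: "\<And>i. i < k \<Longrightarrow> s (t [(i, True)]) = [(i, True)]"
    and ts: "\<And>i. i < k \<Longrightarrow> t (s [(i, True)]) = [(i, True)]"
  shows "s \<in> auto (free_group k)"
proof -
  have id: "(\<lambda>x. x) \<in> hom (free_group k) (free_group k)" by (simp add: hom_def)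
  have "(s \<circ> t) w = w" "(t \<circ> s) w = w" if "w \<in> F k" for w
    using hom_eq_on_F[OF hom_compose[OF t s(1)] id _ that]
      hom_eq_on_F[OF hom_compose[OF s(1) t] id _ that] st ts by auto
  moreover have "s w \<in> F k" "t w \<in> F k" if "w \<in> F k" for w
    using s t that by (auto simp: hom_def)
  ultimately have "bij_betw s (F k) (F k)"
    by (intro bij_betw_byWitness[where f' = t]) auto
  then show ?thesis using s by (auto simp: auto_def Bij_def)
qed

lemma free_embedding_comp:
  "free_embedding k m s \<Longrightarrow> free_embedding m n b \<Longrightarrow> free_embedding k n (b \<circ> s)"
  unfolding free_embedding_def
  by (intro conjI hom_compose[of s _ "free_group m"] comp_inj_on)
    (auto simp: hom_def elim: inj_on_subset)

lemma auto_emb: "s \<in> auto (free_group k) \<Longrightarrow> free_embedding k k s"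
  by (simp add: auto_F_iff)

text \<open>
  The letter \<open>e\<close> is multiplied by \<open>d\<close> from the left. With \<open>e\<close> an inverse
  letter this multiplies the basis element by \<open>flip d\<close> from the right, so one family covers both kinds
  of moves.
\<close>

definition nielsen_move :: "nat \<Rightarrow> fletter \<Rightarrow> fletter \<Rightarrow> fletter list \<Rightarrow> fletter list" where
  "nielsen_move k d e = extend k k (\<lambda>i. if i = fst e
     then if snd e then [d, e] else [flip e, flip d] else [(i, True)])"

lemma nielsen_move_hom:
  assumes "fst d < k" "fst e < k" "fst d \<noteq> fst e"
  shows "nielsen_move k d e \<in> hom (free_group k) (free_group k)"
  unfolding nielsen_move_def using assms
  by (intro extend_hom) (auto simp: F_iff flip_def)

lemma pair_letter: "[d] \<cdot> [e] = (if e = flip d then [] else [d, e])"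
  by (simp add: wmult_def)

lemma letter_cases: "fst c = fst d \<longleftrightarrow> c = d \<or> c = flip d"
  by (auto simp: flip_def prod_eq_iff)

lemma nielsen_move_letter:
  assumes "fst d < k" "fst e < k" "fst d \<noteq> fst e" "fst c < k"
  shows "nielsen_move k d e [c] =
    (if c = e then [d, e] else if c = flip e then [flip e, flip d] else [c])"
proof -
  let ?m = "nielsen_move k d e"
  interpret m: group_hom "free_group k" "free_group k" ?m
    using nielsen_move_hom[OF assms(1-3)] by unfold_locales
  have pos: "?m [(i, True)] = (if i = fst e then if snd e then [d, e] else [flip e, flip d]
      else [(i, True)])" if "i < k" for i
    unfolding nielsen_move_def using that assms by (subst extend_letter) (auto simp: F_iff flip_def)
  have neg: "?m [flip (i, True)] = winv (?m [(i, True)])" if "i < k" for i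
    using m.hom_inv[of "[(i, True)]"] that m.hom_closed[of "[(i, True)]"] by simp
  obtain i s where c: "c = (i, s)" by (cases c)
  show ?thesis
  proof (cases s)
    case True
    then show ?thesis using pos[of i] c assms by (cases e) (auto simp: flip_def)
  next
    case False
    then have "c = flip (i, True)" using c by (simp add: flip_def)
    then show ?thesis using neg[of i] pos[of i] c assms False by (cases e) (auto simp: flip_def)
  qed
qed

text \<open>
  The bound admits the Nielsen moves as well as the automorphisms that remain at the end of the Nielsen reduction,
  whose length is estimated by counting dual walls.
\<close>

definition short_autos :: "nat \<Rightarrow> (fletter list \<Rightarrow> fletter list) set" where
  "short_autos k = {s \<in> auto (free_group k). \<forall>i<k. length (s [(i, True)]) \<le> 4 * k + 2}"

lemma nielsen_move_auto:
  assumes "fst d < k" "fst e < k" "fst d \<noteq> fst e"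
  shows "nielsen_move k d e \<in> auto (free_group k)"
proof (rule auto_FI[where t = "nielsen_move k (flip d) e"])
  have inverse: "nielsen_move k d e (nielsen_move k (flip d) e [c]) = [c]"
    if d: "fst d < k" "fst d \<noteq> fst e" and c: "fst c < k" for c d
  proof -
    let ?m = "nielsen_move k d e"
    have hom: "?m \<in> hom (free_group k) (free_group k)" by (rule nielsen_move_hom) (use assms d in auto)
    have two: "?m [a, b] = ?m [a] \<cdot> ?m [b]" if "fst a < k" "fst b < k" "b \<noteq> flip a" for a b
      using hom_mult[OF hom, of "[a]" "[b]"] that by (simp add: pair_letter)
    have ne: "d \<noteq> e" "d \<noteq> flip e" "flip d \<noteq> e" "flip d \<noteq> flip e"
      using d by (auto simp: flip_def prod_eq_iff)
    show ?thesis
      using assms d c ne two[of "flip d" e] two[of "flip e" d]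
      by (simp add: nielsen_move_letter wmult_def)
  qed
  show "nielsen_move k d e (nielsen_move k (flip d) e [(i, True)]) = [(i, True)]" if "i < k" for i
    using inverse[of d "(i, True)"] assms that by simp
  show "nielsen_move k (flip d) e (nielsen_move k d e [(i, True)]) = [(i, True)]" if "i < k" for i
    using inverse[of "flip d" "(i, True)"] assms that by simp
qed (use assms nielsen_move_hom in \<open>auto simp: nielsen_move_def extend_extensional\<close>)

lemma nielsen_move_short:
  assumes "fst d < k" "fst e < k" "fst d \<noteq> fst e"
  shows "nielsen_move k d e \<in> short_autos k"
  using assms by (auto simp: short_autos_def nielsen_move_auto nielsen_move_letter)


section \<open>Nielsen reduction\<close>

text \<open>
  The value of the word as a numeral in base \<open>2 * n\<close>, least significant digit first. Changing a prefix
  then changes the value by an amount that does not depend on the rest of the word.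
\<close>

fun word_code :: "nat \<Rightarrow> fletter list \<Rightarrow> nat" where
  "word_code n [] = 0"
| "word_code n (a # w) = (2 * fst a + of_bool (snd a)) + 2 * n * word_code n w"

lemma word_code_append: "word_code n (p @ t) = word_code n p + (2 * n) ^ length p * word_code n t"
  by (induction p) (auto simp: algebra_simps)

lemma word_code_eqD:
  "length p = length q \<Longrightarrow> fst ` set p \<subseteq> {..<n} \<Longrightarrow> fst ` set q \<subseteq> {..<n} \<Longrightarrow> word_code n p = word_code n q \<Longrightarrow> p = q"
proof (induction p q rule: list_induct2)
  case (Cons a p b q)
  let ?c = "\<lambda>a::fletter. 2 * fst a + of_bool (snd a) :: nat"
  have lt: "?c a < 2 * n" "?c b < 2 * n" using Cons.prems by (auto simp: of_bool_def)
  have eq: "?c a + 2 * n * word_code n p = ?c b + 2 * n * word_code n q" using Cons.prems by simp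
  then have "(?c a + 2 * n * word_code n p) mod (2 * n) = (?c b + 2 * n * word_code n q) mod (2 * n)" by (rule arg_cong)
  then have c: "?c a = ?c b" using lt by (simp only: mod_mult_self2 mod_less)
  then have "word_code n p = word_code n q" using eq lt by simp
  moreover have "a = b" using c by (cases a; cases b; cases "snd a"; cases "snd b"; simp; presburger)
  ultimately show ?case using Cons by simp
qed simp

definition first_half :: "'a list \<Rightarrow> 'a list" where
  "first_half w = take ((length w + 1) div 2) w"

definition total_length :: "nat \<Rightarrow> (fletter list \<Rightarrow> fletter list) \<Rightarrow> nat" where
  "total_length k b = (\<Sum>c | fst c < k. length (b [c]))"

text \<open>
  Moves that keep the total length may run in circles. The codes of the first halves of all basis words and their
  inverses break these ties.
\<close>

definition total_code :: "nat \<Rightarrow> nat \<Rightarrow> (fletter list \<Rightarrow> fletter list) \<Rightarrow> nat" where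
  "total_code k n b = (\<Sum>c | fst c < k. word_code n (first_half (b [c])))"

lemma finite_letters [simp]: "finite {c :: fletter. fst c < k}"
  by (rule finite_subset[of _ "{..<k} \<times> UNIV"]) auto

text \<open>
  A Nielsen move changes only the terms of \<open>e\<close> and \<open>flip e\<close>. The equation has no
  differences because it is about natural numbers.
\<close>

lemma sum_letters_move:
  fixes g :: "fletter list \<Rightarrow> nat"
  assumes b: "free_embedding k n b" and de: "fst d < k" "fst e < k" "fst d \<noteq> fst e"
  shows "(\<Sum>c | fst c < k. g ((b \<circ> nielsen_move k d e) [c])) + g (b [e]) + g (winv (b [e])) =
    (\<Sum>c | fst c < k. g (b [c])) + g (b [d] \<cdot> b [e]) + g (winv (b [d] \<cdot> b [e]))"
proof -
  let ?b = "b \<circ> nielsen_move k d e" and ?A = "{c :: fletter. fst c < k}"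
  have ne: "e \<noteq> flip e" by simp
  have split: "(\<Sum>c\<in>?A. h c) = (\<Sum>c\<in>?A - {e, flip e}. h c) + h e + h (flip e)" for h :: "fletter \<Rightarrow> nat"
    using sum.subset_diff[of "{e, flip e}" ?A h] de ne by simp
  have "fst d \<noteq> fst e \<Longrightarrow> e \<noteq> flip d" by auto
  then have de_F: "[d, e] = [d] \<cdot> [e]" using de by (simp add: pair_letter)
  have "[flip e, flip d] = winv ([d] \<cdot> [e])" unfolding de_F[symmetric] by simp
  moreover have "b (winv ([d] \<cdot> [e])) = winv (b [d] \<cdot> b [e])"
    using de free_embedding_winv[OF b, of "[d] \<cdot> [e]"] free_embedding_mult[OF b, of "[d]" "[e]"] F_mult by simp
  moreover have "b ([d] \<cdot> [e]) = b [d] \<cdot> b [e]" using free_embedding_mult[OF b] de by simp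
  ultimately have new: "?b [e] = b [d] \<cdot> b [e]" "?b [flip e] = winv (b [d] \<cdot> b [e])"
    using de de_F ne by (simp_all add: nielsen_move_letter)
  have old: "b [flip e] = winv (b [e])" using free_embedding_winv[OF b, of "[e]"] de by simp
  have same: "?b [c] = b [c]" if "c \<in> ?A - {e, flip e}" for c
    using that de by (simp add: nielsen_move_letter)
  show ?thesis
    unfolding split[of "\<lambda>c. g (?b [c])"] split[of "\<lambda>c. g (b [c])"] new old
    using same by (simp del: comp_apply)
qed

text \<open>
  By minimal total length no image loses more than half of its letters to a neighbour. If \<open>b [d]\<close> is
  used up, it therefore loses one half on each side: \<open>b [d]\<close> is \<open>p @ winv q\<close> with
  \<open>p\<close> and \<open>q\<close> of equal length, where \<open>b [c]\<close> starts with \<open>p\<close>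
  and \<open>b [e]\<close> with \<open>q\<close>. The moves that exchange one of these prefixes for the other keep
  all lengths, and minimality of the code for both moves gives \<open>p = q\<close>. But then \<open>p @ winv
  q\<close> is not reduced.
\<close>

lemma minimal_nielsen_reduced:
  assumes b: "free_embedding k n b"
    and min_len: "\<And>d e. fst d < k \<Longrightarrow> fst e < k \<Longrightarrow> fst d \<noteq> fst e \<Longrightarrow>
      total_length k b \<le> total_length k (b \<circ> nielsen_move k d e)"
    and min_code: "\<And>d e. fst d < k \<Longrightarrow> fst e < k \<Longrightarrow> fst d \<noteq> fst e \<Longrightarrow>
      total_length k (b \<circ> nielsen_move k d e) = total_length k b \<Longrightarrow>
      total_code k n b \<le> total_code k n (b \<circ> nielsen_move k d e)"
  shows "nielsen_reduced k b"
proof -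
  have bF: "b [c] \<in> F n" if "fst c < k" for c using free_embedding_closed[OF b] that by simp
  have red: "reduced_word (b [c])" if "fst c < k" for c using bF[OF that] by auto
  have inv: "b [flip c] = winv (b [c])" if "fst c < k" for c
    using free_embedding_winv[OF b, of "[c]"] that by simp
  have inv': "winv (b [flip c]) = b [c]" if "fst c < k" for c
    using inv[OF that] by simp
  have prod: "b [d] \<cdot> b [e] = take (length (b [d]) - m) (b [d]) @ drop m (b [e])"
    if "fst d < k" "fst e < k" "m = lcp_length (b [flip d]) (b [e])" for d e m
    using winv_mult_lcp[of "b [flip d]" "b [e]"] red[of "flip d"] red[of e] that
    by (simp add: inv' winv_drop) (simp add: inv)
  have len: "length (b [e]) \<le> length (b [d] \<cdot> b [e])" if "fst d < k" "fst e < k" "fst d \<noteq> fst e" for d e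
    using min_len[OF that] sum_letters_move[OF b that, of length] unfolding total_length_def by simp
  have cp_half: "2 * lcp_length (b [c]) (b [d]) \<le> length (b [d])" if cd: "fst c < k" "fst d < k" "c \<noteq> d" for c d
  proof (cases "fst c = fst d")
    case True
    then have "c = flip d" using letter_cases cd by auto
    moreover have "b [d] \<noteq> []" using free_embedding_eq_Nil_iff[OF b, of "[d]"] cd by simp
    ultimately show ?thesis
      using lcp_length_winv[of "b [d]"] red[of d] cd by (simp add: inv lcp_length_commute)
  next
    case False
    have "length (b [c]) \<le> length (winv (b [d]) \<cdot> b [c])"
      using len[of "flip d" c] False cd by (simp add: inv)
    then show ?thesis
      using length_winv_mult[of "b [d]" "b [c]"] red cd by (simp add: lcp_length_commute)
  qed
  \<comment> \<open>The move for \<open>d\<close> and \<open>e\<close> replaces the prefix \<open>q\<close> of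
  \<open>b [e]\<close> by \<open>p\<close>. It keeps the length and affects the first half of \<open>b [e]\<close>,
  but not that of its inverse.\<close>
  have tie: "word_code n (take h (b [flip d])) \<le> word_code n (take h (b [d]))"
    if de: "fst d < k" "fst e < k" "fst d \<noteq> fst e"
      and h: "length (b [d]) = 2 * h" "lcp_length (b [flip d]) (b [e]) = h" for d e h
  proof -
    define p q e' where "p = take h (b [d])" and "q = take h (b [flip d])" and "e' = drop h (b [e])"
    define H where "H = (length (b [e]) + 1) div 2"
    have hd: "2 * h \<le> length (b [e])"
      using cp_half[of "flip d" e] de h letter_cases[of e d] by auto
    have eq_e: "b [e] = q @ e'"
      using take_lcp_length[of "b [flip d]" "b [e]"] h(2) by (simp add: q_def e'_def)
    have eq_de: "b [d] \<cdot> b [e] = p @ e'"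
      using prod[OF de(1,2) refl] h by (simp add: p_def e'_def)
    have lens: "length p = h" "length q = h" "length e' = length (b [e]) - h"
      using h hd de by (simp_all add: p_def q_def e'_def inv)
    have same_len: "length (b [d] \<cdot> b [e]) = length (b [e])"
      using eq_de lens hd by simp
    have H: "h \<le> H" "H \<le> length e'" using hd lens by (auto simp: H_def)
    have "total_length k (b \<circ> nielsen_move k d e) = total_length k b"
      using sum_letters_move[OF b de, of length] same_len by (simp add: total_length_def)
    from min_code[OF de this]
    have "word_code n (first_half (b [e])) + word_code n (first_half (winv (b [e]))) \<le>
        word_code n (first_half (b [d] \<cdot> b [e])) + word_code n (first_half (winv (b [d] \<cdot> b [e])))"
      using sum_letters_move[OF b de, of "\<lambda>w. word_code n (first_half w)"] by (simp add: total_code_def)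
    moreover have "first_half w = take H w" if "length w = length (b [e])" for w :: "fletter list"
      using that by (simp add: first_half_def H_def)
    then have "first_half (b [e]) = take H (q @ e')"
      "first_half (b [d] \<cdot> b [e]) = take H (p @ e')"
      "first_half (winv (b [e])) = take H (winv e' @ winv q)"
      "first_half (winv (b [d] \<cdot> b [e])) = take H (winv e' @ winv p)"
      using same_len unfolding eq_de by (simp_all add: eq_e)
    ultimately show ?thesis using lens H
      by (simp add: word_code_append p_def[symmetric] q_def[symmetric])
  qed
  show ?thesis unfolding nielsen_reduced_def
  proof (intro allI impI, elim conjE, rule ccontr)
    fix c d e assume cde: "fst c < k" "fst d < k" "fst e < k" "c \<noteq> d" "e \<noteq> flip d"
      and ge: "\<not> lcp_length (b [c]) (b [d]) + lcp_length (b [flip d]) (b [e]) < length (b [d])"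
    define h where "h = lcp_length (b [c]) (b [d])"
    have nonempty: "b [d] \<noteq> []" using free_embedding_eq_Nil_iff[OF b, of "[d]"] cde by simp
    have "2 * h \<le> length (b [d])" using cp_half[of c d] cde by (simp add: h_def)
    moreover have "2 * lcp_length (b [flip d]) (b [e]) \<le> length (b [d])"
      using cp_half[of e "flip d"] cde by (simp add: lcp_length_commute inv)
    ultimately have h: "length (b [d]) = 2 * h" "lcp_length (b [flip d]) (b [e]) = h"
      using ge by (auto simp: h_def)
    have strict: "2 * lcp_length (b [d]) (b [flip d]) < length (b [d])"
      using lcp_length_winv[OF red nonempty] cde by (simp add: inv)
    have "fst c \<noteq> fst d" using letter_cases[of c d] cde h strict by (auto simp: h_def lcp_length_commute)
    then have "word_code n (take h (b [d])) \<le> word_code n (take h (b [flip d]))"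
      using tie[of "flip d" c h] cde h by (simp add: inv h_def lcp_length_commute)
    moreover have "fst d \<noteq> fst e" using letter_cases[of e d] cde h strict by (auto simp: lcp_length_commute)
    then have "word_code n (take h (b [flip d])) \<le> word_code n (take h (b [d]))"
      using tie[of d e h] cde h by simp
    ultimately have vals: "word_code n (take h (b [d])) = word_code n (take h (b [flip d]))" by (rule antisym)
    have "take h (b [c]) \<in> F n" if "fst c < k" for c using bF[OF that] by simp
    then have sub: "fst ` set (take h (b [c])) \<subseteq> {..<n}" if "fst c < k" for c
      using that unfolding F_iff by blast
    have "length (take h (b [d])) = length (take h (b [flip d]))" using cde by (simp add: inv)
    then have "take h (b [d]) = take h (b [flip d])"
      using word_code_eqD[OF _ sub sub vals] cde by simp
    then have "h \<le> lcp_length (b [d]) (b [flip d])" using h cde by (intro lcp_length_geI) (auto simp: inv)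
    then show False using strict h by simp
  qed
qed

lemma auto_compose:
  assumes "s \<in> auto (free_group k)" "t \<in> auto (free_group k)"
  shows "s \<otimes>\<^bsub>AutoGroup (free_group k)\<^esub> t = compose (F k) s t"
  using FG.AutoGroup_simps(3)[OF assms] .

theorem nielsen_reduction:
  assumes b: "free_embedding k n b"
  obtains s where "s \<in> generate (AutoGroup (free_group k)) (short_autos k)"
    "free_embedding k n (b \<circ> s)" "nielsen_reduced k (b \<circ> s)"
proof -
  let ?A = "AutoGroup (free_group k)"
  let ?N = "generate ?A (short_autos k)"
  interpret A: group ?A by (rule FG.AutoGroup)
  have carr: "carrier ?A = auto (free_group k)" by (rule FG.AutoGroup_simps)
  have sub: "short_autos k \<subseteq> carrier ?A" by (auto simp: short_autos_def carr)
  have auto: "s \<in> auto (free_group k)" if "s \<in> ?N" for s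
    using A.generate_in_carrier[OF sub that] carr by simp
  \<comment> \<open>First the total length is minimised, then the code among the minima.\<close>
  obtain s0 where s0: "s0 \<in> ?N" "\<And>s. s \<in> ?N \<Longrightarrow> total_length k (b \<circ> s0) \<le> total_length k (b \<circ> s)"
    using ex_has_least_nat[of "\<lambda>s. s \<in> ?N" "\<one>\<^bsub>?A\<^esub>" "\<lambda>s. total_length k (b \<circ> s)"] generate.one by blast
  obtain s where s: "s \<in> ?N" "total_length k (b \<circ> s) = total_length k (b \<circ> s0)"
    "\<And>t. t \<in> ?N \<Longrightarrow> total_length k (b \<circ> t) = total_length k (b \<circ> s0) \<Longrightarrow>
      total_code k n (b \<circ> s) \<le> total_code k n (b \<circ> t)"
    using ex_has_least_nat[of "\<lambda>s. s \<in> ?N \<and> total_length k (b \<circ> s) = total_length k (b \<circ> s0)" s0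
      "\<lambda>s. total_code k n (b \<circ> s)"] s0 by blast
  have emb: "free_embedding k n (b \<circ> s)" by (rule free_embedding_comp[OF auto_emb[OF auto[OF s(1)]] b])
  have "\<exists>t\<in>?N. total_length k (b \<circ> s \<circ> nielsen_move k d e) = total_length k (b \<circ> t) \<and>
      total_code k n (b \<circ> s \<circ> nielsen_move k d e) = total_code k n (b \<circ> t)"
    if de: "fst d < k" "fst e < k" "fst d \<noteq> fst e" for d e
  proof
    let ?m = "nielsen_move k d e"
    have m: "?m \<in> short_autos k" by (rule nielsen_move_short[OF de])
    show t: "s \<otimes>\<^bsub>?A\<^esub> ?m \<in> ?N" by (rule generate.eng[OF s(1) generate.incl[OF m]])
    have "(b \<circ> s \<circ> ?m) [c] = (b \<circ> (s \<otimes>\<^bsub>?A\<^esub> ?m)) [c]" if "fst c < k" for c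
      using that auto[OF s(1)] m by (simp add: auto_compose short_autos_def compose_eq)
    then show "total_length k (b \<circ> s \<circ> ?m) = total_length k (b \<circ> (s \<otimes>\<^bsub>?A\<^esub> ?m)) \<and>
      total_code k n (b \<circ> s \<circ> ?m) = total_code k n (b \<circ> (s \<otimes>\<^bsub>?A\<^esub> ?m))"
      unfolding total_length_def total_code_def by (intro conjI sum.cong) (auto simp del: comp_apply)
  qed
  then have "nielsen_reduced k (b \<circ> s)"
    using s s0 by (intro minimal_nielsen_reduced[OF emb]) metis+
  then show ?thesis using that s(1) emb by blast
qed

section \<open>Counting with dual walls\<close>

lemma dual_wallsE:
  assumes "dual_walls k n b P"
  obtains v l where "\<And>c. fst c < k \<Longrightarrow> v c \<in> F n"
    "\<And>c g. fst c < k \<Longrightarrow> g \<in> F k \<Longrightarrow> b g \<cdot> P \<in> half_space (v c) (l c) \<longleftrightarrow> starts c g"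
proof -
  have "\<forall>c. \<exists>v l. fst c < k \<longrightarrow> v \<in> F n \<and> (\<forall>g\<in>F k. b g \<cdot> P \<in> half_space v l \<longleftrightarrow> starts c g)"
    using assms unfolding dual_walls_def by blast
  then obtain v l where "\<forall>c. fst c < k \<longrightarrow>
      v c \<in> F n \<and> (\<forall>g\<in>F k. b g \<cdot> P \<in> half_space (v c) (l c) \<longleftrightarrow> starts c g)"
    by metis
  then show ?thesis using that by blast
qed

text \<open>
  Conjugating by \<open>P\<close> reduces to the root as the base vertex.
\<close>

lemma dual_walls_exist:
  assumes b: "free_embedding k n b" and P: "P \<in> F n"
  obtains s where "s \<in> generate (AutoGroup (free_group k)) (short_autos k)"
    "free_embedding k n (b \<circ> s)" "dual_walls k n (b \<circ> s) P"
proof -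
  define b' where "b' g = winv P \<cdot> b g \<cdot> P" for g
  have bF: "b g \<in> F n" if "g \<in> F k" for g using free_embedding_closed[OF b that] .
  have "b' (g \<cdot> h) = b' g \<cdot> b' h" if "g \<in> F k" "h \<in> F k" for g h
    using that P bF[of g] bF[of h] F_reduced[OF P] F_reduced[OF bF]
    by (simp add: b'_def free_embedding_mult[OF b] mult_assoc)
  moreover have "inj_on b' (F k)"
    using P bF F_reduced[OF P] F_reduced[OF bF] free_embedding_eq_iff[OF b]
    by (intro inj_onI) (simp add: b'_def)
  ultimately have b': "free_embedding k n b'"
    using P bF by (auto simp: free_embedding_def hom_def b'_def)
  obtain s where s: "s \<in> generate (AutoGroup (free_group k)) (short_autos k)"
    "free_embedding k n (b' \<circ> s)" "nielsen_reduced k (b' \<circ> s)"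
    using nielsen_reduction[OF b'] .
  interpret A: group "AutoGroup (free_group k)" by (rule FG.AutoGroup)
  have "s \<in> auto (free_group k)"
    using A.generate_in_carrier[OF _ s(1)] by (auto simp: short_autos_def FG.AutoGroup_simps)
  then have semb: "free_embedding k k s" by (rule auto_emb)
  have "dual_walls k n (b \<circ> s) P"
    unfolding dual_walls_def
  proof (intro allI impI)
    fix c :: fletter assume c: "fst c < k"
    obtain v l where v: "v \<in> F n"
      "\<forall>g\<in>F k. (b' \<circ> s) g \<cdot> [] \<in> half_space v l \<longleftrightarrow> starts c g"
      using nielsen_reduced_dual_walls[OF s(2,3), unfolded dual_walls_def, rule_format, OF c] by blast
    have "(b \<circ> s) g \<cdot> P \<in> half_space (P \<cdot> v) l \<longleftrightarrow> starts c g" if g: "g \<in> F k" for g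
    proof -
      have red: "reduced_word P" "reduced_word v" using P v(1) by auto
      then have "(b' \<circ> s) g \<cdot> [] = winv P \<cdot> (b \<circ> s) g \<cdot> P" by (simp add: b'_def)
      then show ?thesis
        using v(2) g half_space_translate[OF red, of "(b \<circ> s) g \<cdot> P" l] red by (metis mult_reduced)
    qed
    then show "\<exists>v\<in>F n. \<exists>l. \<forall>g\<in>F k. (b \<circ> s) g \<cdot> P \<in> half_space v l \<longleftrightarrow> starts c g"
      using v(1) P by blast
  qed
  then show ?thesis using that s(1) free_embedding_comp[OF semb b] by blast
qed

text \<open>
  The inverse of a prefix of \<open>w\<close> moves the next edge on the path to \<open>w\<close> to the root,
  where it separates the images of the two ends of the path.
\<close>

lemma prefix_wall:
  assumes w: "reduced_word w" and p: "p < length w"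
  shows "\<not> starts (w ! p) (winv (take p w))" "starts (w ! p) (winv (take p w) \<cdot> w)"
proof -
  have "winv (take p w) \<cdot> w = winv (take p w) \<cdot> (take p w \<cdot> drop p w)"
    using w by (simp add: take_mult_drop)
  also have "\<dots> = w ! p # drop (Suc p) w" using w p by (simp add: Cons_nth_drop_Suc)
  finally show "starts (w ! p) (winv (take p w) \<cdot> w)" by simp
  have "reduced_word (take p w @ [w ! p])"
    using w p reduced_take[of w "Suc p"] by (simp add: take_Suc_conv_app_nth)
  then show "\<not> starts (w ! p) (winv (take p w))"
    by (cases "take p w" rule: rev_cases) (auto simp: reduced_append)
qed

lemma letter_nth_F: "w \<in> F k \<Longrightarrow> p < length w \<Longrightarrow> fst (w ! p) < k"
  by (force simp: F_iff)

text \<open>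
  The dual edges \<open>(v c, l c)\<close> are fixed once and for all, since the counting arguments compare their
  translates.
\<close>

locale walled_embedding =
  fixes k n b P v l
  assumes emb: "free_embedding k n b" and P: "P \<in> F n"
    and wall_F: "\<And>c. fst c < k \<Longrightarrow> v c \<in> F n"
    and wall: "\<And>c g. fst c < k \<Longrightarrow> g \<in> F k \<Longrightarrow> b g \<cdot> P \<in> half_space (v c) (l c) \<longleftrightarrow> starts c g"
begin

lemma bF [simp]: "g \<in> F k \<Longrightarrow> b g \<in> F n"
  by (rule free_embedding_closed[OF emb])

lemma red [simp]: "g \<in> F k \<Longrightarrow> reduced_word (b g)" "reduced_word P"
    "fst c < k \<Longrightarrow> reduced_word (v c)"
  using bF P wall_F by blast+

lemma translated_wall:
  assumes "h \<in> F k" "g \<in> F k" "fst c < k"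
  shows "b g \<cdot> P \<in> half_space (b h \<cdot> v c) (l c) \<longleftrightarrow> starts c (winv h \<cdot> g)"
proof -
  have "winv (b h) \<cdot> b g \<cdot> P = b (winv h \<cdot> g) \<cdot> P"
    using assms by (simp add: free_embedding_mult[OF emb] free_embedding_winv[OF emb] mult_assoc)
  then show ?thesis
    using assms wall[of c "winv h \<cdot> g"] by (subst half_space_translate) auto
qed

lemma position_wall:
  assumes w: "w \<in> F k" and p: "p < length w"
  shows "P \<notin> half_space (b (take p w) \<cdot> v (w ! p)) (l (w ! p))"
    and "b w \<cdot> P \<in> half_space (b (take p w) \<cdot> v (w ! p)) (l (w ! p))"
  using translated_wall[of "take p w" "[]" "w ! p"] translated_wall[of "take p w" w "w ! p"]
    prefix_wall[of w p] F_reduced[OF w] w p letter_nth_F[OF w p]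
  by (auto simp: free_embedding_Nil[OF emb])

text \<open>
  The edges on the path to \<open>w\<close> in the tree of the domain become distinct translates of dual edges, one
  for each position of \<open>w\<close>, if the letter is recorded as well.
\<close>

lemma length_le_count:
  assumes w: "w \<in> F k" and R: "finite R"
    and sub: "\<And>p. p < length w \<Longrightarrow> b (take p w) \<cdot> v (w ! p) \<in> R"
  shows "length w \<le> card {c :: fletter. fst c < k} * card R"
proof -
  let ?f = "\<lambda>p. (w ! p, b (take p w) \<cdot> v (w ! p))"
  have "inj_on ?f {..<length w}"
  proof (rule inj_onI)
    fix p p' assume pp: "p \<in> {..<length w}" "p' \<in> {..<length w}" and "?f p = ?f p'"
    then have "w ! p = w ! p'" "b (take p w) \<cdot> v (w ! p) = b (take p' w) \<cdot> v (w ! p')"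
      unfolding prod.inject by blast+
    then have "b (take p w) = b (take p' w)" using w pp letter_nth_F[OF w] by simp
    then have "take p w = take p' w" using free_embedding_eq_iff[OF emb] w by simp
    then have "length (take p w) = length (take p' w)" by (rule arg_cong)
    then show "p = p'" using pp by simp
  qed
  moreover have "?f ` {..<length w} \<subseteq> {c. fst c < k} \<times> R"
    using sub letter_nth_F[OF w] by auto
  ultimately have "card {..<length w} \<le> card ({c :: fletter. fst c < k} \<times> R)"
    using R by (intro card_inj_on_le[of ?f]) auto
  then show ?thesis by (simp add: card_cartesian_product)
qed

text \<open>
  The path from \<open>P\<close> to its translate by a basis element enters only one translate of a dual half-tree,
  the one that defines duality for this basis element.
\<close>

lemma crossing_path_to_letter:
  assumes c: "fst c < k" and z: "z = winv P \<cdot> b [c] \<cdot> P" and s: "s < length z"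
    and hd: "h \<in> F k" "fst d < k"
    and cross: "P \<cdot> take s z \<notin> half_space (b h \<cdot> v d) (l d)"
      "P \<cdot> take (Suc s) z \<in> half_space (b h \<cdot> v d) (l d)"
  shows "P \<cdot> take s z = v c"
proof -
  have red_z: "reduced_word z" using z by simp
  have "P \<cdot> take (Suc s) z = (P \<cdot> take s z) \<cdot> [z ! s]"
    using s red_z by (simp add: take_Suc_mult mult_assoc)
  then have eq: "P \<cdot> take s z = b h \<cdot> v d" "z ! s = l d"
    using enters_half_space[of "P \<cdot> take s z" "b h \<cdot> v d" "l d" "z ! s"] cross hd red_z by auto
  have cancel: "winv (b h \<cdot> v d) = winv (take s z) \<cdot> winv P"
    unfolding eq(1)[symmetric] using red_z by (simp add: winv_mult)
  have "P \<notin> half_space (b h \<cdot> v d) (l d)"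
    using prefix_wall(1)[OF red_z s] red_z eq(2)
    by (simp add: half_space_def cancel mult_assoc)
  then have 1: "\<not> starts d (winv h)"
    using translated_wall[of h "[]" d] hd by (auto simp: free_embedding_Nil[OF emb])
  have "b [c] \<cdot> P = P \<cdot> z" using c by (simp add: z)
  then have "b [c] \<cdot> P \<in> half_space (b h \<cdot> v d) (l d)"
    using prefix_wall(2)[OF red_z s] red_z eq(2)
    by (simp add: half_space_def cancel mult_assoc)
  then have 2: "starts d (winv h \<cdot> [c])"
    using translated_wall[of h "[c]" d] hd c by simp
  have "winv h = []" "c = d" using crosses_into[OF _ 1 2] hd by auto
  then show ?thesis using eq(1) c by (simp add: free_embedding_Nil[OF emb])
qed

end

text \<open>
  If \<open>y\<close> can be followed by its own first letter, all powers of \<open>y\<close> are reduced as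
  written.
\<close>

lemma concat_power_reduced:
  assumes "reduced_word (y @ [m])" "starts m y"
  shows "reduced_word (concat (replicate N y) @ [m])"
proof (induction N)
  case (Suc N)
  have "hd (concat (replicate N y) @ [m]) = m"
    using assms(2) by (cases N) (auto simp: starts_def)
  then have "reduced_word (y @ (concat (replicate N y) @ [m]))"
    unfolding reduced_append[of y] using Suc assms reduced_append[of y "[m]"] by auto
  then show ?case by simp
qed simp

context walled_embedding begin

text \<open>
  Suppose the path visits the same orbit of oriented edges at times \<open>q < q'\<close> and enters no dual
  half-tree in between. The element \<open>w\<close> that takes the vertex \<open>u\<close> of the first visit to
  that of the second acts as a translation whose axis passes through \<open>u\<close>, and no translate of a dual
  half-tree is entered along the axis. A translate that contains the image of \<open>P\<close> under
  \<open>w\<^sup>N\<close> but not \<open>P\<close> itself must then separate \<open>P\<close> from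
  \<open>u\<close> or the image of \<open>P\<close> from the image of \<open>u\<close>. Hence the powers of
  \<open>w\<close> have bounded length, so two of them agree, although they move \<open>u\<close> by different
  distances.
\<close>

lemma no_return_without_crossing:
  assumes c: "fst c < k" and z: "z = winv P \<cdot> b [c] \<cdot> P" and r: "r \<in> F n"
    and q: "q < q'" "q' < length z" "z ! q = z ! q'"
    and g: "g \<in> F k" "P \<cdot> take q z = b g \<cdot> r" and g': "g' \<in> F k" "P \<cdot> take q' z = b g' \<cdot> r"
    and avoid: "\<And>s. q \<le> s \<Longrightarrow> s < q' \<Longrightarrow> P \<cdot> take s z \<noteq> v c"
  shows False
proof -
  define u where "u = P \<cdot> take q z"
  define y where "y = drop q (take q' z)"
  define w where "w = g' \<cdot> winv g"
  define pw where "pw N = w [^]\<^bsub>free_group k\<^esub> (N::nat)" for N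
  have red_z: "reduced_word z" using z by simp
  have red_u [simp]: "reduced_word u" using red_z by (simp add: u_def)
  have red_r: "reduced_word r" using r by auto
  have w: "w \<in> F k" using g g' by (simp add: w_def)
  have pw: "pw N \<in> F k" for N unfolding pw_def by (rule FG.nat_pow_closed[OF w])
  have pw_Suc: "pw (Suc N) = pw N \<cdot> w" for N by (simp add: pw_def)
  have "take q z @ y = take q' z"
    using q by (metis y_def append_take_drop_id min.absorb1 less_imp_le take_take)
  then have uy: "u \<cdot> y = P \<cdot> take q' z"
    unfolding u_def using red_z by (metis mult_append mult_assoc reduced_append reduced_take)
  have wu: "b w \<cdot> u = P \<cdot> take q' z"
    using g g' red_r by (simp add: u_def w_def free_embedding_mult[OF emb] free_embedding_winv[OF emb] mult_assoc)
  \<comment> \<open>A translate of a dual half-tree that contains the vertex of the second visit was not entered in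
  between.\<close>
  have mono: "u \<in> half_space (b h \<cdot> v d) (l d)"
    if "h \<in> F k" "fst d < k" and in': "P \<cdot> take q' z \<in> half_space (b h \<cdot> v d) (l d)" for h d
  proof (rule ccontr)
    assume nin: "u \<notin> half_space (b h \<cdot> v d) (l d)"
    let ?A = "\<lambda>s. P \<cdot> take (q + s) z \<in> half_space (b h \<cdot> v d) (l d)"
    have "?A (q' - q)" "\<not> ?A 0" using in' nin q by (simp_all add: u_def)
    then have "\<exists>s<q' - q. (\<forall>i\<le>s. \<not> ?A i) \<and> ?A (Suc s)" 
      by (intro ex_least_nat_less[where P = ?A and n = "q' - q"])
    then obtain s where s: "s < q' - q" "\<not> ?A s" "?A (Suc s)" by auto
    then have "P \<cdot> take (q + s) z = v c"
      using crossing_path_to_letter[OF c z, of "q + s" h d] that q by simp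
    then show False using avoid[of "q + s"] s by simp
  qed
  \<comment> \<open>Monotonicity under \<open>w\<close> is iterated by translating with the powers of
  \<open>w\<close>.\<close>
  have mono_pw: "u \<in> half_space (b h \<cdot> v d) (l d)"
    if "h \<in> F k" "fst d < k" "b (pw N) \<cdot> u \<in> half_space (b h \<cdot> v d) (l d)" for N h d
    using that(3)
  proof (induction N)
    case 0
    then show ?case by (simp add: pw_def free_embedding_Nil[OF emb])
  next
    case (Suc N)
    have tr: "x \<in> half_space (b (winv (pw N) \<cdot> h) \<cdot> v d) (l d) \<longleftrightarrow>
        b (pw N) \<cdot> x \<in> half_space (b h \<cdot> v d) (l d)" if "reduced_word x" for x
    proof -
      have "b (winv (pw N) \<cdot> h) \<cdot> v d = winv (b (pw N)) \<cdot> (b h \<cdot> v d)"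
        using pw[of N] \<open>h \<in> F k\<close> \<open>fst d < k\<close>
        by (simp add: free_embedding_mult[OF emb] free_embedding_winv[OF emb] mult_assoc)
      then show ?thesis
        using half_space_translate[of "winv (b (pw N))" "b h \<cdot> v d" x "l d"] that pw[of N]
          \<open>h \<in> F k\<close> \<open>fst d < k\<close> by simp
    qed
    have "b (pw (Suc N)) \<cdot> u = b (pw N) \<cdot> (P \<cdot> take q' z)"
      using pw[of N] w by (simp add: pw_Suc free_embedding_mult[OF emb] mult_assoc wu)
    then have "P \<cdot> take q' z \<in> half_space (b (winv (pw N) \<cdot> h) \<cdot> v d) (l d)"
      using Suc.prems tr[of "P \<cdot> take q' z"] red_z by simp
    then have "u \<in> half_space (b (winv (pw N) \<cdot> h) \<cdot> v d) (l d)"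
      using mono pw[of N] that by simp
    then show ?case using tr[of u] Suc.IH by simp
  qed
  \<comment> \<open>Both halves of the set \<open>R\<close> below have at most \<open>Suc q\<close> elements, the
  vertices of the path to \<open>u\<close> and of its image.\<close>
  define K where "K = card {c :: fletter. fst c < k} * (2 * Suc q)"
  have bounded: "length (pw N) \<le> K" for N
  proof -
    define R where "R = (\<lambda>s. P \<cdot> take s (take q z)) ` {..q} \<union>
      (\<lambda>s. (b (pw N) \<cdot> P) \<cdot> take s (take q z)) ` {..q}"
    have "card R \<le> 2 * Suc q"
      unfolding R_def
      using card_Un_le[of "(\<lambda>s. P \<cdot> take s (take q z)) ` {..q}"
          "(\<lambda>s. (b (pw N) \<cdot> P) \<cdot> take s (take q z)) ` {..q}"]
        card_image_le[of "{..q}" "\<lambda>s. P \<cdot> take s (take q z)"]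
        card_image_le[of "{..q}" "\<lambda>s. (b (pw N) \<cdot> P) \<cdot> take s (take q z)"] by simp
    moreover have "length (pw N) \<le> card {c :: fletter. fst c < k} * card R"
    proof (rule length_le_count[OF pw])
      show "finite R" by (simp add: R_def)
      fix p assume p: "p < length (pw N)"
      let ?h = "take p (pw N)" and ?d = "pw N ! p"
      have h: "?h \<in> F k" and d: "fst ?d < k" using pw letter_nth_F[OF pw p] by auto
      note pos = position_wall[OF pw p]
      have len: "length (take q z) \<le> q" by simp
      show "b ?h \<cdot> v ?d \<in> R"
      proof (cases "b (pw N) \<cdot> u \<in> half_space (b ?h \<cdot> v ?d) (l ?d)")
        case True
        then have "u \<in> half_space (b ?h \<cdot> v ?d) (l ?d)" by (rule mono_pw[OF h d])
        then obtain s where "s \<le> length (take q z)" "b ?h \<cdot> v ?d = P \<cdot> take s (take q z)"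
          using wall_on_path[of "take q z" P "b ?h \<cdot> v ?d" "l ?d"] pos(1) red_z h d
          unfolding u_def by auto
        then show ?thesis using len unfolding R_def by (intro UnI1 image_eqI[of _ _ s]) auto
      next
        case False
        then have "(b (pw N) \<cdot> P) \<cdot> take q z \<notin> half_space (b ?h \<cdot> v ?d) (l ?d)"
          using red_z by (simp add: u_def mult_assoc)
        then obtain s where "s \<le> length (take q z)"
          "b ?h \<cdot> v ?d = (b (pw N) \<cdot> P) \<cdot> take s (take q z)"
          using wall_on_path[of "take q z" "b (pw N) \<cdot> P" "b ?h \<cdot> v ?d" "l ?d"] pos(2) red_z h d
            pw[of N] by auto
        then show ?thesis using len unfolding R_def by (intro UnI2 image_eqI[of _ _ s]) auto
      qed
    qed
    ultimately show ?thesis unfolding K_def by (meson le_trans mult_le_mono2)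
  qed
  have y: "y = z ! q # drop (Suc q) (take q' z)"
    using q Cons_nth_drop_Suc[of q "take q' z"] unfolding y_def by simp
  have "take q z @ y @ [z ! q] = take (Suc q') z"
    using \<open>take q z @ y = take q' z\<close> q by (metis append.assoc take_Suc_conv_app_nth)
  then have "reduced_word (y @ [z ! q])"
    using red_z by (metis reduced_append reduced_take)
  then have red_power: "reduced_word (concat (replicate N y))" for N
    using concat_power_reduced[of y "z ! q" N] y reduced_append by (metis starts_simps(2))
  \<comment> \<open>On the axis the power \<open>w\<^sup>N\<close> moves \<open>u\<close> along the periodic path
  with period \<open>y\<close>.\<close>
  have power: "b (pw N) \<cdot> u = u \<cdot> concat (replicate N y)" for N
  proof (induction N)
    case 0
    then show ?case by (simp add: pw_def free_embedding_Nil[OF emb])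
  next
    case (Suc N)
    have "pw N \<cdot> w = w \<cdot> pw N"
      using FG.nat_pow_Suc2[OF w, of N] by (simp add: pw_def)
    then have "b (pw (Suc N)) \<cdot> u = b w \<cdot> (b (pw N) \<cdot> u)"
      using pw[of N] w by (simp add: pw_Suc free_embedding_mult[OF emb] mult_assoc)
    also have "\<dots> = (b w \<cdot> u) \<cdot> concat (replicate N y)"
      using Suc red_power by (simp add: mult_assoc)
    also have "\<dots> = u \<cdot> (y \<cdot> concat (replicate N y))"
      unfolding wu uy[symmetric] using red_power by (simp add: mult_assoc)
    also have "y \<cdot> concat (replicate N y) = concat (replicate (Suc N) y)"
      using mult_append[of y "concat (replicate N y)"] red_power[of "Suc N"] by simp
    finally show ?case .
  qed
  have "inj pw"
  proof (rule injI)
    fix N M assume "pw N = pw M"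
    then have "concat (replicate N y) = concat (replicate M y)"
      using power[of N] power[of M] red_power by simp
    then have "length (concat (replicate N y)) = length (concat (replicate M y))" by (rule arg_cong)
    then have "N * length y = M * length y" by (simp add: length_concat sum_list_replicate)
    moreover have "length y \<noteq> 0" by (simp add: y)
    ultimately show "N = M" by simp
  qed
  moreover have "finite (range pw)"
  proof (rule finite_subset)
    show "range pw \<subseteq> {w. set w \<subseteq> {c. fst c < k} \<and> length w \<le> K}"
      using bounded pw by (fastforce simp: F_iff)
    show "finite {w. set w \<subseteq> {c :: fletter. fst c < k} \<and> length w \<le> K}"
      by (rule finite_lists_length_le) simp
  qed
  ultimately show False using finite_imageD[of pw UNIV] by simp
qed

text \<open>
  The single crossing of a dual edge splits the path into two parts, and each part meets the orbit at most once.
\<close>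

lemma coset_visits_le_2:
  assumes c: "fst c < k" and z: "z = winv P \<cdot> b [c] \<cdot> P" and r: "r \<in> F n"
  shows "card {q. q < length z \<and> z ! q = m \<and> (\<exists>g\<in>F k. P \<cdot> take q z = b g \<cdot> r)} \<le> 2"
    (is "card ?Q \<le> 2")
proof -
  have red_z: "reduced_word z" using z by simp
  have "\<exists>q0. \<forall>s<length z. P \<cdot> take s z = v c \<longrightarrow> s = q0"
  proof (cases "\<exists>q0<length z. P \<cdot> take q0 z = v c")
    case True
    then obtain q0 where q0: "q0 < length z" "P \<cdot> take q0 z = v c" by blast
    have "s = q0" if s: "s < length z" "P \<cdot> take s z = v c" for s
    proof -
      have "P \<cdot> take s z = P \<cdot> take q0 z" using s q0 by simp
      then have "take s z = take q0 z" using red_z by simp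
      then have "length (take s z) = length (take q0 z)" by (rule arg_cong)
      then show ?thesis using s q0 by simp
    qed
    then show ?thesis by blast
  qed blast
  then obtain q0 where q0: "\<And>s. s < length z \<Longrightarrow> P \<cdot> take s z = v c \<Longrightarrow> s = q0" by blast
  have no_pair: False
    if Q: "q \<in> ?Q" "q' \<in> ?Q" and less: "q < q'" and side: "q' \<le> q0 \<or> q0 < q" for q q'
  proof -
    obtain g g' where g: "g \<in> F k" "P \<cdot> take q z = b g \<cdot> r"
      and g': "g' \<in> F k" "P \<cdot> take q' z = b g' \<cdot> r"
      using Q by blast
    have q': "q' < length z" "z ! q = z ! q'" using Q by simp_all
    show False
    proof (rule no_return_without_crossing[OF c z r less q' g g'])
      fix s assume s: "q \<le> s" "s < q'"
      show "P \<cdot> take s z \<noteq> v c"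
        using q0[of s] s q'(1) side by linarith
    qed
  qed
  have one: "card A \<le> 1" if "A \<subseteq> ?Q" "\<And>q q'. q \<in> A \<Longrightarrow> q' \<in> A \<Longrightarrow> q < q' \<Longrightarrow> False" for A
  proof -
    have "finite A" using that(1) by (rule finite_subset) simp
    moreover have "\<forall>x\<in>A. \<forall>y\<in>A. x = y" using that(2) by (metis linorder_neqE_nat)
    ultimately show ?thesis by (simp add: card_le_Suc0_iff_eq)
  qed
  \<comment> \<open>The time \<open>q0\<close> of the crossing belongs to the first part: the vertex of the visit
  at \<open>q0\<close> lies before the edge.\<close>
  define Q where "Q = ?Q"
  have "Q = (Q \<inter> {..q0}) \<union> (Q \<inter> {q0<..})" by auto
  then have "card Q = card ((Q \<inter> {..q0}) \<union> (Q \<inter> {q0<..}))" by (rule arg_cong)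
  also have "\<dots> \<le> card (Q \<inter> {..q0}) + card (Q \<inter> {q0<..})" by (rule card_Un_le)
  also have "\<dots> \<le> 1 + 1"
  proof (rule add_mono; rule one)
    show "Q \<inter> {..q0} \<subseteq> ?Q" "Q \<inter> {q0<..} \<subseteq> ?Q" by (simp_all add: Q_def)
    show False if "q \<in> Q \<inter> {..q0}" "q' \<in> Q \<inter> {..q0}" "q < q'" for q q'
      using no_pair[of q q'] that by (simp add: Q_def)
    show False if "q \<in> Q \<inter> {q0<..}" "q' \<in> Q \<inter> {q0<..}" "q < q'" for q q'
      using no_pair[of q q'] that by (simp add: Q_def)
  qed
  finally show ?thesis by (simp add: Q_def)
qed

end

section \<open>Finite generation of the automorphism group\<close>

interpretation AutF: group "AutoGroup (free_group n)" for n
  by (rule FG.AutoGroup)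

lemma carrier_AutF [simp]: "carrier (AutoGroup (free_group n)) = auto (free_group n)"
  by (rule FG.AutoGroup_simps)

lemma mult_AutF_apply:
  "s \<in> auto (free_group n) \<Longrightarrow> t \<in> auto (free_group n) \<Longrightarrow> w \<in> F n \<Longrightarrow>
    (s \<otimes>\<^bsub>AutoGroup (free_group n)\<^esub> t) w = s (t w)"
  by (simp add: auto_compose compose_eq)

lemma one_AutF_apply: "w \<in> F n \<Longrightarrow> \<one>\<^bsub>AutoGroup (free_group n)\<^esub> w = w"
  by (simp add: FG.AutoGroup_simps)

lemma auto_F_closed: "s \<in> auto (free_group n) \<Longrightarrow> w \<in> F n \<Longrightarrow> s w \<in> F n"
  using free_embedding_closed[OF auto_emb] .

lemma inv_AutF_apply:
  assumes "s \<in> auto (free_group n)" "w \<in> F n"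
  shows "(inv\<^bsub>AutoGroup (free_group n)\<^esub> s) (s w) = w"
    and "s ((inv\<^bsub>AutoGroup (free_group n)\<^esub> s) w) = w"
proof -
  have "inv\<^bsub>AutoGroup (free_group n)\<^esub> s \<in> auto (free_group n)"
    using AutF.inv_closed[of s n] assms by simp
  then show "(inv\<^bsub>AutoGroup (free_group n)\<^esub> s) (s w) = w"
    and "s ((inv\<^bsub>AutoGroup (free_group n)\<^esub> s) w) = w"
    using assms mult_AutF_apply[of "inv\<^bsub>AutoGroup (free_group n)\<^esub> s" n s w]
      mult_AutF_apply[of s n "inv\<^bsub>AutoGroup (free_group n)\<^esub> s" w] one_AutF_apply[of w n]
    by (simp_all)
qed

lemma inv_AutF_auto: "s \<in> auto (free_group n) \<Longrightarrow> inv\<^bsub>AutoGroup (free_group n)\<^esub> s \<in> auto (free_group n)"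
  using AutF.inv_closed[of s n] by simp

lemma mult_AutF_auto:
  "s \<in> auto (free_group n) \<Longrightarrow> t \<in> auto (free_group n) \<Longrightarrow>
    s \<otimes>\<^bsub>AutoGroup (free_group n)\<^esub> t \<in> auto (free_group n)"
  using AutF.m_closed[of s n t] by simp

lemma auto_F_eqI:
  assumes "s \<in> auto (free_group n)" "t \<in> auto (free_group n)"
    and "\<And>i. i < n \<Longrightarrow> s [(i, True)] = t [(i, True)]"
  shows "s = t"
proof (rule extensionalityI[of _ "F n"])
  show "s w = t w" if "w \<in> F n" for w
    using hom_eq_on_F[of s n n t] assms that by (auto simp: auto_def)
qed (use assms in \<open>auto simp: auto_F_iff\<close>)

lemma card_letters: "card {c :: fletter. fst c < k} = 2 * k"
proof -
  have "{c :: fletter. fst c < k} = {..<k} \<times> UNIV" by auto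
  then show ?thesis by (simp add: card_cartesian_product)
qed

lemma finite_short_words: "finite {w \<in> F k. length w \<le> K}"
proof (rule finite_subset)
  show "{w \<in> F k. length w \<le> K} \<subseteq> {w. set w \<subseteq> {c. fst c < k} \<and> length w \<le> K}"
    by (auto simp: F_iff)
  show "finite {w. set w \<subseteq> {c :: fletter. fst c < k} \<and> length w \<le> K}"
    by (rule finite_lists_length_le) simp
qed

lemma finite_bounded_autos:
  "finite {s \<in> auto (free_group k). \<forall>i<k. length (s [(i, True)]) \<le> K}" (is "finite ?S")
proof (rule finite_imageD)
  let ?r = "\<lambda>s. \<lambda>i\<in>{..<k}. s [(i, True)]"
  show "finite (?r ` ?S)"
  proof (rule finite_subset)
    show "?r ` ?S \<subseteq> {..<k} \<rightarrow>\<^sub>E {w \<in> F k. length w \<le> K}"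
      by (intro image_subsetI restrict_PiE_iff[THEN iffD2]) (simp add: auto_F_closed)
    show "finite ({..<k} \<rightarrow>\<^sub>E {w \<in> F k. length w \<le> K})"
      by (intro finite_PiE finite_short_words) simp
  qed
  show "inj_on ?r ?S"
  proof (rule inj_onI)
    fix s t assume st: "s \<in> ?S" "t \<in> ?S" "?r s = ?r t"
    show "s = t"
    proof (rule auto_F_eqI[of _ k])
      show "s [(i, True)] = t [(i, True)]" if "i < k" for i
        using fun_cong[OF st(3), of i] that by simp
    qed (use st in auto)
  qed
qed

text \<open>
  Nielsen reduction multiplies an automorphism by short ones until it has dual walls. The inverse \<open>t\<close>
  of the result is short: a basis element is separated from the root by one edge only, and the length of its
  preimage is bounded by a count of edges between them.
\<close>

theorem AutF_finite_generating_set: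
  "finite_generating_set (AutoGroup (free_group n)) (short_autos n)"
  unfolding finite_generating_set_def
proof (intro conjI)
  let ?A = "AutoGroup (free_group n)"
  let ?N = "generate ?A (short_autos n)"
  show fin: "finite (short_autos n)" unfolding short_autos_def by (rule finite_bounded_autos)
  show sub: "short_autos n \<subseteq> carrier ?A" by (auto simp: short_autos_def)
  have N: "subgroup ?N ?A" by (rule AutF.generate_is_subgroup[OF sub])
  have "p \<in> ?N" if p: "p \<in> auto (free_group n)" for p
  proof -
    obtain s where s: "s \<in> ?N" "free_embedding n n (p \<circ> s)" "dual_walls n n (p \<circ> s) []"
      using dual_walls_exist[OF auto_emb[OF p], of "[]"] by auto
    have sa: "s \<in> auto (free_group n)" using subgroup.mem_carrier[OF N s(1)] by simp
    obtain v l where w: "walled_embedding n n (p \<circ> s) [] v l"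
      using dual_wallsE[OF s(3)] s(2) unfolding walled_embedding_def by (metis F_Nil)
    interpret w: walled_embedding n n "p \<circ> s" "[]" v l by fact
    let ?ps = "p \<otimes>\<^bsub>?A\<^esub> s"
    let ?t = "inv\<^bsub>?A\<^esub> ?ps"
    have ps: "?ps \<in> auto (free_group n)" by (rule mult_AutF_auto[OF p sa])
    have ta: "?t \<in> auto (free_group n)" by (rule inv_AutF_auto[OF ps])
    have "length (?t [(i, True)]) \<le> 4 * n + 2" if i: "i < n" for i
    proof -
      let ?g = "?t [(i, True)]"
      have g: "?g \<in> F n" using auto_F_closed[OF ta] i by simp
      have "(p \<circ> s) ?g = ?ps ?g" using mult_AutF_apply[OF p sa g] by simp
      also have "\<dots> = [(i, True)]" using inv_AutF_apply(2)[OF ps] i by simp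
      finally have img: "(p \<circ> s) ?g = [(i, True)]" .
      have "length ?g \<le> card {c :: fletter. fst c < n} * card {[], [(i, True)]}"
      proof (rule w.length_le_count[OF g])
        fix j assume j: "j < length ?g"
        let ?u = "(p \<circ> s) (take j ?g) \<cdot> v (?g ! j)"
        have "reduced_word ?u" using letter_nth_F[OF g j] by simp
        then obtain q where "q \<le> length [(i, True)]" "?u = [] \<cdot> take q [(i, True)]"
          using wall_on_path[of "[(i, True)]" "[]" ?u "l (?g ! j)"] w.position_wall[OF g j]
          unfolding img by auto
        then show "?u \<in> {[], [(i, True)]}" by (cases q) auto
      qed simp
      then show ?thesis by (simp add: card_letters)
    qed
    then have "?t \<in> ?N" using ta by (intro generate.incl) (simp add: short_autos_def)
    then have "inv\<^bsub>?A\<^esub> ?t \<otimes>\<^bsub>?A\<^esub> inv\<^bsub>?A\<^esub> s \<in> ?N"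
      using s(1) subgroup.m_closed[OF N] subgroup.m_inv_closed[OF N] by blast
    also have "inv\<^bsub>?A\<^esub> ?t \<otimes>\<^bsub>?A\<^esub> inv\<^bsub>?A\<^esub> s = p"
      using p sa ps AutF.m_assoc[of p n s "inv\<^bsub>?A\<^esub> s"] inv_AutF_auto[OF sa] by simp
    finally show ?thesis .
  qed
  then show "?N = carrier ?A" using subgroup.subset[OF N] by auto
qed


section \<open>Bounded change of dual bases\<close>

lemma half_space_Nil: "u \<in> half_space [] l \<longleftrightarrow> starts l u"
  by (simp add: half_space_def)

text \<open>
  Only finitely many edges \<open>(y, m)\<close> cross the preimage of a half-tree at the root under an
  automorphism, since the image of an edge is a path of bounded length that has to pass the root.
\<close>

lemma finite_coboundary:
  assumes t: "t \<in> auto (free_group n)"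
  shows "finite {(y, m). y \<in> F n \<and> fst m < n \<and> (\<exists>l. \<not> starts l (t y) \<and> starts l (t (y \<cdot> [m])))}"
    (is "finite ?B")
proof (rule finite_subset)
  let ?i = "inv\<^bsub>AutoGroup (free_group n)\<^esub> t"
  let ?C = "\<Union>m\<in>{m. fst m < n}. (\<lambda>q. (?i (winv (take q (t [m]))), m)) ` {..length (t [m])}"
  show "finite ?C" by simp
  show "?B \<subseteq> ?C"
  proof (rule subsetI)
    fix x assume "x \<in> ?B"
    then obtain y m l where x: "x = (y, m)" and y: "y \<in> F n" and m: "fst m < n"
      and l: "\<not> starts l (t y)" "starts l (t (y \<cdot> [m]))" by blast
    have red: "reduced_word (t y)" "reduced_word (t [m])"
      using auto_F_closed[OF t y] auto_F_closed[OF t, of "[m]"] m by auto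
    have "t (y \<cdot> [m]) = t y \<cdot> t [m]" using free_embedding_mult[OF auto_emb[OF t] y, of "[m]"] m by simp
    then have "(t y \<in> half_space [] l) \<noteq> (t y \<cdot> t [m] \<in> half_space [] l)"
      using l by (simp add: half_space_Nil)
    then obtain q where q: "q \<le> length (t [m])" "[] = t y \<cdot> take q (t [m])"
      using wall_on_path[of "t [m]" "t y" "[]" l] red by auto
    then have "winv (take q (t [m])) = (t y \<cdot> take q (t [m])) \<cdot> winv (take q (t [m]))"
      by (metis Nil_mult)
    also have "\<dots> = t y" using red by (simp add: mult_assoc)
    finally have "y = ?i (winv (take q (t [m])))" using inv_AutF_apply(1)[OF t y] by simp
    then show "x \<in> ?C" using x m q(1) by blast
  qed
qed

lemma dual_walls_choice:
  assumes "free_embedding k n b" "P \<in> F n" "dual_walls k n b P"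
  obtains v l where "walled_embedding k n b P v l"
proof -
  obtain v l where "\<And>c. fst c < k \<Longrightarrow> v c \<in> F n"
    "\<And>c g. fst c < k \<Longrightarrow> g \<in> F k \<Longrightarrow> b g \<cdot> P \<in> half_space (v c) (l c) \<longleftrightarrow> starts c g"
    using dual_wallsE[OF assms(3)] by blast
  then show ?thesis using that[of v l] assms(1,2) by (simp add: walled_embedding_def)
qed

text \<open>
  The number of positions in \<open>w = s [c]\<close> is estimated by the translates of the dual edges of
  \<open>b\<close> that separate \<open>P\<close> from \<open>b w \<cdot> P\<close>. The automorphism
  \<open>t\<close> turns such a translate into a set \<open>Z\<close> that separates the ends of the path
  \<open>z\<close> of the new tree; so \<open>z\<close> has an edge in the coboundary of \<open>Z\<close>, which is
  a translate of one of the finitely many edges in \<open>B\<close>. The path \<open>z\<close> visits the orbit of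
  each of these at most twice.
\<close>

theorem dual_basis_change_bounded:
  assumes t: "t \<in> auto (free_group n)"
  obtains K where "\<And>b s P c. \<lbrakk>free_embedding k n b; s \<in> auto (free_group k); P \<in> F n;
    dual_walls k n b P; dual_walls k n (t \<circ> b \<circ> s) (t P); fst c < k\<rbrakk> \<Longrightarrow> length (s [c]) \<le> K"
proof -
  let ?L = "{c :: fletter. fst c < k}"
  let ?i = "inv\<^bsub>AutoGroup (free_group n)\<^esub> t"
  define B where
    "B = {(y, m). y \<in> F n \<and> fst m < n \<and> (\<exists>l. \<not> starts l (?i y) \<and> starts l (?i (y \<cdot> [m])))}"
  have ia: "?i \<in> auto (free_group n)" by (rule inv_AutF_auto[OF t])
  have fin_B: "finite B" unfolding B_def by (rule finite_coboundary[OF ia])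
  have temb: "free_embedding n n t" and iemb: "free_embedding n n ?i" by (simp_all add: auto_emb t ia)
  have it: "?i (t x) = x" "t (?i x) = x" if "x \<in> F n" for x
    using inv_AutF_apply[OF t that] .
  have tF: "t x \<in> F n" "?i x \<in> F n" if "x \<in> F n" for x
    using auto_F_closed t ia that by blast+
  \<comment> \<open>One factor for the letter recorded in \<open>length_le_count\<close>, one for the dual edge,
  and two visits per coboundary edge.\<close>
  define K where "K = card ?L * (card ?L * (card B * 2))"
  have "length (s [c]) \<le> K"
    if b: "free_embedding k n b" and s: "s \<in> auto (free_group k)" and P: "P \<in> F n"
      and dual: "dual_walls k n b P" and dual': "dual_walls k n (t \<circ> b \<circ> s) (t P)"
      and c: "fst c < k" for b s P c
  proof -
    obtain v l where "walled_embedding k n b P v l" using dual_walls_choice[OF b P dual] .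
    then interpret b: walled_embedding k n b P v l .
    have emb': "free_embedding k n (t \<circ> b \<circ> s)"
      using free_embedding_comp[OF auto_emb[OF s] free_embedding_comp[OF b temb]] .
    obtain v' l' where "walled_embedding k n (t \<circ> b \<circ> s) (t P) v' l'"
      using dual_walls_choice[OF emb' tF(1)[OF P] dual'] .
    then interpret b': walled_embedding k n "t \<circ> b \<circ> s" "t P" v' l' .
    define w where "w = s [c]"
    have w: "w \<in> F k" unfolding w_def using auto_F_closed[OF s] c by simp
    define z where "z = winv (t P) \<cdot> t (b w) \<cdot> t P"
    have z: "z = winv (t P) \<cdot> (t \<circ> b \<circ> s) [c] \<cdot> t P" by (simp add: z_def w_def)
    have zF: "z \<in> F n" using P tF w by (simp add: z_def)
    define V where "V r m = {q. q < length z \<and> z ! q = m \<and>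
      (\<exists>g\<in>F k. t P \<cdot> take q z = (t \<circ> b \<circ> s) g \<cdot> r)}" for r m
    have card_V: "card (V r m) \<le> 2" if "r \<in> F n" for r m
      unfolding V_def by (rule b'.coset_visits_le_2[OF c z that])
    define R where "R d y m = (\<lambda>q. ?i ((t P \<cdot> take q z) \<cdot> winv y)) ` V (t (v d) \<cdot> y) m" for d y m
    have card_R: "card (R d y m) \<le> 2" if "fst d < k" "y \<in> F n" for d y m
    proof -
      have "finite (V (t (v d) \<cdot> y) m)" by (simp add: V_def)
      then have "card (R d y m) \<le> card (V (t (v d) \<cdot> y) m)" unfolding R_def by (rule card_image_le)
      also have "\<dots> \<le> 2" using card_V that tF b.wall_F by simp
      finally show ?thesis .
    qed
    let ?R = "\<Union>d\<in>?L. \<Union>(y, m)\<in>B. R d y m"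
    have fin_R: "finite ?R" using fin_B by (auto simp: R_def V_def)
    have "card ?R \<le> (\<Sum>d\<in>?L. card (\<Union>(y, m)\<in>B. R d y m))" by (rule card_UN_le) simp
    also have "\<dots> \<le> (\<Sum>d\<in>?L. card B * 2)"
    proof (rule sum_mono)
      fix d assume d: "d \<in> ?L"
      have "card (\<Union>(y, m)\<in>B. R d y m) \<le> (\<Sum>(y, m)\<in>B. card (R d y m))"
        using card_UN_le[OF fin_B, of "\<lambda>(y, m). R d y m"] by (simp add: case_prod_unfold)
      also have "\<dots> \<le> (\<Sum>(y, m)\<in>B. 2)"
      proof (rule sum_mono)
        fix x assume "x \<in> B"
        then show "(case x of (y, m) \<Rightarrow> card (R d y m)) \<le> (case x of (y, m) \<Rightarrow> 2)"
          using card_R[of d "fst x" "snd x"] d by (cases x) (simp add: B_def)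
      qed
      finally show "card (\<Union>(y, m)\<in>B. R d y m) \<le> card B * 2" by (simp add: case_prod_unfold)
    qed
    finally have card_R_all: "card ?R \<le> card ?L * (card B * 2)" by simp
    have "length w \<le> card ?L * card ?R"
    proof (rule b.length_le_count[OF w fin_R])
      fix p assume p: "p < length w"
      define h d where "h = take p w" and "d = w ! p"
      have h: "h \<in> F k" and d: "fst d < k" using w letter_nth_F[OF w p] by (simp_all add: h_def d_def)
      note pos = b.position_wall[OF w p, folded h_def d_def]
      let ?x = "b h \<cdot> v d"
      have x: "?x \<in> F n" using h d b.bF b.wall_F by simp
      define Z where "Z u \<longleftrightarrow> ?i u \<in> half_space ?x (l d)" for u
      have red_z: "reduced_word z" and red_tP: "reduced_word (t P)" using zF tF[OF P] by auto
      have "\<not> Z (t P)" using pos(1) it P by (simp add: Z_def)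
      moreover have "t P \<cdot> z = t (b w \<cdot> P)"
        using free_embedding_mult[OF temb, of "b w" P] w P b.bF tF[of "b w"] tF[OF P] red_tP
        by (simp add: z_def)
      then have "Z (t P \<cdot> z)" using pos(2) it w P b.bF by (simp add: Z_def)
      ultimately obtain q where q: "q < length z" "\<not> Z (t P \<cdot> take q z)"
        "Z (t P \<cdot> take q z \<cdot> [z ! q])"
        using path_enters[OF red_z red_tP] by blast
      define u where "u = t P \<cdot> take q z"
      have u: "u \<in> F n" using tF P zF by (simp add: u_def)
      have m: "fst (z ! q) < n" by (rule letter_nth_F[OF zF q(1)])
      have um: "Z (u \<cdot> [z ! q])" using q(3) by (simp add: u_def mult_assoc)
      define y where "y = winv (t ?x) \<cdot> u"
      have y: "y \<in> F n" using u tF x by (simp add: y_def)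
      have iy: "?i (y \<cdot> a) = winv ?x \<cdot> ?i (u \<cdot> a)" if a: "a \<in> F n" for a
      proof -
        have "y \<cdot> a = winv (t ?x) \<cdot> (u \<cdot> a)" using a by (auto simp: y_def mult_assoc)
        then show ?thesis
          using free_embedding_mult[OF iemb, of "winv (t ?x)" "u \<cdot> a"]
            free_embedding_winv[OF iemb, of "t ?x"] x u a tF it by simp
      qed
      have "(y, z ! q) \<in> B"
        using y m q(2) um iy[of "[]"] iy[of "[z ! q]"] F_reduced[OF u] F_reduced[OF y]
        unfolding B_def Z_def half_space_def u_def[symmetric] by auto
      moreover have "?x \<in> R d y (z ! q)"
      proof -
        define g where "g = (inv\<^bsub>AutoGroup (free_group k)\<^esub> s) h"
        have g: "g \<in> F k" "s g = h"
          using auto_F_closed[OF inv_AutF_auto[OF s] h] inv_AutF_apply(2)[OF s h] by (simp_all add: g_def)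
        have tx: "t ?x = t (b h) \<cdot> t (v d)"
          using free_embedding_mult[OF temb] h d b.bF b.wall_F by simp
        have "u = t ?x \<cdot> y" using tF[OF x] u by (auto simp: y_def)
        then have "u = (t \<circ> b \<circ> s) g \<cdot> (t (v d) \<cdot> y)"
          using g y by (auto simp: tx mult_assoc)
        then have "q \<in> V (t (v d) \<cdot> y) (z ! q)"
          using q(1) g(1) unfolding V_def u_def by blast
        moreover have "?x = ?i (u \<cdot> winv y)"
        proof -
          have "u \<cdot> winv y = t ?x"
            using \<open>u = t ?x \<cdot> y\<close> F_reduced[OF y] F_reduced[OF tF(1)[OF x]] by (simp add: mult_assoc)
          then show ?thesis using it(1)[OF x] by simp
        qed
        ultimately show ?thesis unfolding R_def u_def by blast
      qed
      ultimately show "b (take p w) \<cdot> v (w ! p) \<in> ?R"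
        using d unfolding h_def[symmetric] d_def[symmetric] by blast
    qed
    also have "\<dots> \<le> K" unfolding K_def using card_R_all by (rule mult_le_mono2)
    finally show ?thesis by (simp add: w_def)
  qed
  then show ?thesis using that by blast
qed

section \<open>Dual bases seen from a boundary point\<close>

abbreviation ray :: "nat \<Rightarrow> nat \<Rightarrow> fletter list" where
  "ray k m \<equiv> replicate m (k, True)"

lemma F_mono: "k \<le> n \<Longrightarrow> w \<in> F k \<Longrightarrow> w \<in> F n"
  by (force simp: F_iff)

lemma free_embedding_subgroup: "k \<le> m \<Longrightarrow> free_embedding m n b \<Longrightarrow> free_embedding k n b"
  unfolding free_embedding_def using F_mono[of k m] by (auto simp: hom_def inj_on_def)

lemma replicate_F: "fst c < n \<Longrightarrow> replicate m c \<in> F n"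
proof (induction m)
  case (Suc m)
  then show ?case by (cases m) (auto simp: F_Cons)
qed simp

lemma reduced_replicate: "reduced_word (replicate m c)"
  using replicate_F[of c "Suc (fst c)" m] by auto

lemma ray_Suc: "ray k (Suc m) = ray k m \<cdot> [(k, True)]"
proof -
  have "ray k m @ [(k, True)] = ray k (Suc m)" by (simp add: replicate_append_same)
  moreover have "reduced_word (ray k (Suc m))" by (rule reduced_replicate)
  ultimately show ?thesis using mult_append by metis
qed

lemma mult_ray:
  assumes "g \<in> F k" shows "g \<cdot> ray k m = g @ ray k m"
proof (rule mult_append)
  have "fst (last g) < k" if "g \<noteq> []" using assms last_in_set[OF that] by (auto simp: F_iff)
  then have "(k, True) \<noteq> flip (last g)" if "g \<noteq> []" using that by (auto simp: flip_def)
  then show "reduced_word (g @ ray k m)"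
    using assms by (cases m) (auto simp: reduced_append reduced_replicate simp del: replicate_Suc)
qed

text \<open>
  In the tree this means that the ray leaves every bounded neighbourhood of the subtree of the free factor: its
  limit is not in the boundary of the factor.
\<close>

lemma ray_cosets_distinct:
  assumes "g \<in> F k" "ray k m = g \<cdot> ray k m'"
  shows "m = m'"
proof -
  have eq: "ray k m = g @ ray k m'" using assms mult_ray by simp
  have "g = []"
  proof (rule ccontr)
    assume "g \<noteq> []"
    then have "hd g \<in> set (ray k m)" "hd g \<in> set g" by (simp_all add: eq)
    then show False using assms(1) by (auto simp: F_iff)
  qed
  then show ?thesis using eq by (metis append_Nil length_replicate)
qed

text \<open>
  The half-tree of \<open>c\<close> contains the translates of \<open>P\<close> by all positive powers of
  \<open>c\<close> and by no positive power of \<open>flip c\<close>. The translates of the root lie at a fixed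
  distance from those of \<open>P\<close>, and only finitely many of them can be on the other side. So dual edges
  lie in the subtree spanned by the image of \<open>b\<close>, wherever \<open>P\<close> is.
\<close>

lemma (in walled_embedding) dual_wall_essential:
  assumes c: "fst c < k"
  shows "\<exists>g\<in>F k. b g \<in> half_space (v c) (l c)" "\<exists>g\<in>F k. b g \<notin> half_space (v c) (l c)"
proof -
  have "\<exists>N\<ge>1. b (replicate N e) \<in> half_space (v c) (l c) \<longleftrightarrow>
      b (replicate N e) \<cdot> P \<in> half_space (v c) (l c)" if e: "fst e < k" for e
  proof (rule ccontr)
    assume none: "\<not> ?thesis"
    have "(\<lambda>N. b (replicate N e)) ` {1..} \<subseteq> (\<lambda>q. v c \<cdot> winv (take q P)) ` {..length P}"
    proof (rule image_subsetI)
      fix N :: nat assume "N \<in> {1..}"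
      then have "(b (replicate N e) \<in> half_space (v c) (l c)) \<noteq>
          (b (replicate N e) \<cdot> P \<in> half_space (v c) (l c))" using none by auto
      then obtain q where q: "q \<le> length P" "v c = b (replicate N e) \<cdot> take q P"
        using wall_on_path[of P "b (replicate N e)" "v c" "l c"] c replicate_F[OF e] by auto
      then have "b (replicate N e) = v c \<cdot> winv (take q P)"
        using replicate_F[OF e] by (simp add: mult_assoc)
      then show "b (replicate N e) \<in> (\<lambda>q. v c \<cdot> winv (take q P)) ` {..length P}" using q(1) by blast
    qed
    then have "finite ((\<lambda>N. b (replicate N e)) ` {1..})" by (rule finite_subset) simp
    moreover have "inj_on (\<lambda>N. b (replicate N e)) {1..}"
      using free_embedding_eq_iff[OF emb] replicate_F[OF e] by (intro inj_onI) (simp add: replicate_eq_replicate)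
    ultimately have "finite {1::nat..}" by (rule finite_imageD)
    then show False by (simp add: infinite_Ici)
  qed
  note ex = this
  have st: "starts c (replicate N e) \<longleftrightarrow> e = c" if "N \<ge> 1" for N e
    using that by (cases N) auto
  obtain N where "N \<ge> 1" "b (replicate N c) \<in> half_space (v c) (l c) \<longleftrightarrow>
      b (replicate N c) \<cdot> P \<in> half_space (v c) (l c)" using ex c by blast
  then show "\<exists>g\<in>F k. b g \<in> half_space (v c) (l c)"
    using wall[OF c replicate_F[OF c]] st replicate_F[OF c] by blast
  have fc: "fst (flip c) < k" using c by simp
  obtain N where "N \<ge> 1" "b (replicate N (flip c)) \<in> half_space (v c) (l c) \<longleftrightarrow>
      b (replicate N (flip c)) \<cdot> P \<in> half_space (v c) (l c)" using ex fc by blast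
  then show "\<exists>g\<in>F k. b g \<notin> half_space (v c) (l c)"
    using wall[OF c replicate_F[OF fc]] st replicate_F[OF fc] flip_neq(1) by blast
qed

text \<open>
  Two points of the subgroup are joined by translates of the paths to the images of letters. So, up to translation,
  an edge that separates them is found on one of these finitely many paths.
\<close>

lemma essential_wall_position:
  assumes b: "free_embedding k n b" and x: "x \<in> F n"
    and g: "g \<in> F k" "b g \<in> half_space x l" and g': "g' \<in> F k" "b g' \<notin> half_space x l"
  obtains h c q where "h \<in> F k" "fst c < k" "q \<le> length (b [c])" "x = b h \<cdot> take q (b [c])"
proof -
  define p where "p = winv g' \<cdot> g"
  have p: "p \<in> F k" "g' \<cdot> p = g" using g g' by (auto simp: p_def)
  have "reduced_word p" "reduced_word g'" using p(1) g'(1) by auto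
  then obtain q where q: "q < length p" "b (g' \<cdot> take q p) \<notin> half_space x l"
    "b (g' \<cdot> take q p \<cdot> [p ! q]) \<in> half_space x l"
    using path_enters[of p g' "\<lambda>u. b u \<in> half_space x l"] g g' p by auto
  define h where "h = g' \<cdot> take q p"
  have h: "h \<in> F k" using g' p by (simp add: h_def)
  have c: "fst (p ! q) < k" by (rule letter_nth_F[OF p(1) q(1)])
  have "b (g' \<cdot> take q p \<cdot> [p ! q]) = b h \<cdot> b [p ! q]"
    using free_embedding_mult[OF b h, of "[p ! q]"] c by (simp add: h_def mult_assoc)
  then have "(b h \<in> half_space x l) \<noteq> (b h \<cdot> b [p ! q] \<in> half_space x l)"
    using q by (simp add: h_def)
  moreover have "reduced_word (b [p ! q])" "reduced_word (b h)" "reduced_word x"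
    using F_reduced[OF free_embedding_closed[OF b, of "[p ! q]"]] F_reduced[OF free_embedding_closed[OF b h]]
      F_reduced[OF x] c by simp_all
  ultimately obtain r where "r \<le> length (b [p ! q])" "x = b h \<cdot> take r (b [p ! q])"
    using wall_on_path[of "b [p ! q]" "b h" x l] by blast
  then show ?thesis using that h c by blast
qed

text \<open>
  A point of the ray and the vertex at displacement \<open>p\<close> from it can be distinguished by a dual edge
  only if the point lies in one of finitely many cosets of the free factor, because dual edges are essential. Each
  coset contains at most one point of the ray, so far points are not affected. The bound \<open>m1\<close> does not
  depend on \<open>a\<close>; therefore the dual edges may be chosen after it.
\<close>

lemma dual_walls_shift:
  assumes t: "t \<in> auto (free_group n)" and k: "k < n" and p: "p \<in> F n"
  obtains m1 where "\<And>m a. m \<ge> m1 \<Longrightarrow> a \<in> auto (free_group k) \<Longrightarrow>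
    dual_walls k n (t \<circ> a) (t (ray k m)) \<Longrightarrow> dual_walls k n (t \<circ> a) (t (ray k m) \<cdot> p)"
proof -
  have temb: "free_embedding n n t" by (rule auto_emb[OF t])
  have temb': "free_embedding k n t" using free_embedding_subgroup[OF _ temb] k by simp
  have rayF: "ray k m \<in> F n" for m using replicate_F k by simp
  have tF: "t w \<in> F n" if "w \<in> F n" for w using auto_F_closed[OF t that] .
  have Fkn: "w \<in> F n" if "w \<in> F k" for w using F_mono[OF _ that] k by simp
  have red_p: "reduced_word p" using p by auto
  \<comment> \<open>The cosets in question: their offsets lead from the root along the path to a basis element, and
  then back along the displacement.\<close>
  define E where "E = (\<Union>c\<in>{c. fst c < k}. \<Union>q\<in>{..length (t [c])}.
    (\<lambda>s. take q (t [c]) \<cdot> winv (take s p)) ` {..length p})"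
  have fin_E: "finite E" unfolding E_def by simp
  have E_F: "e \<in> F n" if "e \<in> E" for e
  proof -
    obtain c q s where "fst c < k" "e = take q (t [c]) \<cdot> winv (take s p)"
      using \<open>e \<in> E\<close> unfolding E_def by blast
    then show ?thesis using p tF[of "[c]"] k by simp
  qed
  have "finite {m. \<exists>g\<in>F k. t (ray k m) = t g \<cdot> e}" if e: "e \<in> E" for e
  proof -
    have "m = m'" if m: "g \<in> F k" "t (ray k m) = t g \<cdot> e" and m': "g' \<in> F k" "t (ray k m') = t g' \<cdot> e"
      for m m' g g'
    proof -
      have x: "g \<cdot> winv g' \<in> F k" using m m' by simp
      have "t ((g \<cdot> winv g') \<cdot> ray k m') = t g \<cdot> (winv (t g') \<cdot> t (ray k m'))"
        using m(1) m'(1) Fkn rayF tF F_reduced[OF tF[OF rayF]]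
        by (simp add: free_embedding_mult[OF temb] free_embedding_winv[OF temb] mult_assoc)
      also have "\<dots> = t (ray k m)" using m m' E_F[OF e] by auto
      finally have "(g \<cdot> winv g') \<cdot> ray k m' = ray k m"
        using free_embedding_eq_iff[OF temb] Fkn[OF x] rayF by simp
      then show ?thesis using ray_cosets_distinct[OF x] by metis
    qed
    then have "\<exists>m0. {m. \<exists>g\<in>F k. t (ray k m) = t g \<cdot> e} \<subseteq> {m0}" by blast
    then show ?thesis by (meson finite.emptyI finite.insertI finite_subset)
  qed
  then have "finite (\<Union>e\<in>E. {m. \<exists>g\<in>F k. t (ray k m) = t g \<cdot> e})" using fin_E by blast
  then obtain m1 where "\<forall>m\<in>(\<Union>e\<in>E. {m. \<exists>g\<in>F k. t (ray k m) = t g \<cdot> e}). m < m1"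
    unfolding finite_nat_set_iff_bounded by blast
  then have m1: "t (ray k m) \<noteq> t g \<cdot> e" if "m \<ge> m1" "g \<in> F k" "e \<in> E" for m g e
    using that by (auto simp: not_less[symmetric])
  have "dual_walls k n (t \<circ> a) (t (ray k m) \<cdot> p)"
    if m: "m \<ge> m1" and a: "a \<in> auto (free_group k)" and dual: "dual_walls k n (t \<circ> a) (t (ray k m))" for m a
  proof -
    have emb: "free_embedding k n (t \<circ> a)" by (rule free_embedding_comp[OF auto_emb[OF a] temb'])
    obtain v l where "walled_embedding k n (t \<circ> a) (t (ray k m)) v l"
      using dual_walls_choice[OF emb tF[OF rayF] dual] .
    then interpret e: walled_embedding k n "t \<circ> a" "t (ray k m)" v l .
    have aF: "a g \<in> F k" if "g \<in> F k" for g using auto_F_closed[OF a that] .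
    have "(t \<circ> a) g \<cdot> t (ray k m) \<cdot> p \<in> half_space (v c) (l c) \<longleftrightarrow> starts c g"
      if c: "fst c < k" and g: "g \<in> F k" for c g
    proof (rule ccontr)
      assume "\<not> ?thesis"
      then have "((t \<circ> a) g \<cdot> t (ray k m) \<in> half_space (v c) (l c)) \<noteq>
          (((t \<circ> a) g \<cdot> t (ray k m)) \<cdot> p \<in> half_space (v c) (l c))"
        using e.wall[OF c g] red_p by (simp add: mult_assoc)
      moreover have red: "reduced_word (t (a g))" "reduced_word (t (ray k m))" "reduced_word (v c)"
        using tF rayF Fkn aF[OF g] e.wall_F[OF c] by (blast intro: F_reduced)+
      ultimately obtain s where s: "s \<le> length p" "v c = (t (a g) \<cdot> t (ray k m)) \<cdot> take s p"
        using wall_on_path[of p "(t \<circ> a) g \<cdot> t (ray k m)" "v c" "l c"] red_p by auto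
      obtain g1 g2 where gs: "g1 \<in> F k" "(t \<circ> a) g1 \<in> half_space (v c) (l c)"
        "g2 \<in> F k" "(t \<circ> a) g2 \<notin> half_space (v c) (l c)"
        using e.dual_wall_essential[OF c] by blast
      then obtain h d q where h: "h \<in> F k" "fst d < k" "q \<le> length (t [d])"
        "v c = t h \<cdot> take q (t [d])"
        using essential_wall_position[OF temb' e.wall_F[OF c] aF[OF gs(1)] gs(2)[unfolded comp_apply]
            aF[OF gs(3)] gs(4)[unfolded comp_apply]] by blast
      let ?e = "take q (t [d]) \<cdot> winv (take s p)"
      have e: "?e \<in> E" unfolding E_def using h s(1) by blast
      have "t (winv (a g) \<cdot> h) \<cdot> ?e = winv (t (a g)) \<cdot> (t h \<cdot> take q (t [d])) \<cdot> winv (take s p)"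
        using aF[OF g] h(1) red_p by (simp add: free_embedding_mult[OF temb'] free_embedding_winv[OF temb'] mult_assoc)
      also have "\<dots> = winv (t (a g)) \<cdot> ((t (a g) \<cdot> t (ray k m)) \<cdot> take s p) \<cdot> winv (take s p)"
        using h(4) s(2) by simp
      also have "\<dots> = t (ray k m)" using red red_p by (simp add: mult_assoc)
      finally show False using m1[OF m _ e, of "winv (a g) \<cdot> h"] aF[OF g] h(1) by simp
    qed
    then show ?thesis unfolding dual_walls_def using e.wall_F by blast
  qed
  then show ?thesis using that by blast
qed

text \<open>
  Here \<open>t\<close> is the inverse of the automorphism that changes the marking, and \<open>a\<close> is a
  basis of the free factor, given as an automorphism, that is dual to edges as seen from the end of the ray.
\<close>

definition dual_basis ::
    "nat \<Rightarrow> nat \<Rightarrow> (fletter list \<Rightarrow> fletter list) \<Rightarrow> (fletter list \<Rightarrow> fletter list) \<Rightarrow> bool" where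
  "dual_basis k n t a \<longleftrightarrow> (\<forall>\<^sub>F m in sequentially. dual_walls k n (t \<circ> a) (t (ray k m)))"

lemma dual_walls_cong:
  "(\<And>g. g \<in> F k \<Longrightarrow> b g = b' g) \<Longrightarrow> dual_walls k n b P \<longleftrightarrow> dual_walls k n b' P"
  by (simp add: dual_walls_def)

text \<open>
  A basis that is dual to edges as seen from one far point of the ray stays so along the rest of the ray.
\<close>

lemma dual_basis_exists:
  assumes t: "t \<in> auto (free_group n)" and k: "k < n"
  obtains a where "a \<in> auto (free_group k)" "dual_basis k n t a"
proof -
  have temb: "free_embedding n n t" by (rule auto_emb[OF t])
  have rayF: "ray k m \<in> F n" for m using replicate_F k by simp
  have xF: "[(k, True)] \<in> F n" using k by simp
  obtain m1 where m1: "\<And>m a. m \<ge> m1 \<Longrightarrow> a \<in> auto (free_group k) \<Longrightarrow>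
    dual_walls k n (t \<circ> a) (t (ray k m)) \<Longrightarrow> dual_walls k n (t \<circ> a) (t (ray k m) \<cdot> t [(k, True)])"
    using dual_walls_shift[OF t k auto_F_closed[OF t xF]] by blast
  obtain a where a: "a \<in> generate (AutoGroup (free_group k)) (short_autos k)"
    "dual_walls k n (t \<circ> a) (t (ray k m1))"
    using dual_walls_exist[OF free_embedding_subgroup[OF _ temb] auto_F_closed[OF t rayF], of k m1] k by auto
  have aa: "a \<in> auto (free_group k)"
    using AutF.generate_in_carrier[OF _ a(1)] by (auto simp: short_autos_def)
  have "dual_walls k n (t \<circ> a) (t (ray k m))" if "m \<ge> m1" for m
    using that
  proof (induction rule: dec_induct)
    case (step m)
    have "t (ray k (Suc m)) = t (ray k m) \<cdot> t [(k, True)]"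
      unfolding ray_Suc by (rule free_embedding_mult[OF temb rayF xF])
    then show ?case using m1[OF step(1) aa step.IH] by (simp only:)
  qed (fact a(2))
  then show ?thesis using that aa unfolding dual_basis_def eventually_sequentially by blast
qed

text \<open>
  Conjugation moves the points of the ray by a fixed displacement, besides translating the tree. This is why the
  construction descends to outer automorphisms.
\<close>

lemma dual_basis_conj:
  assumes t: "t \<in> auto (free_group n)" and k: "k < n" and x: "x \<in> F n"
    and a: "a \<in> auto (free_group k)" and dual: "dual_basis k n t a"
    and t': "\<And>w. w \<in> F n \<Longrightarrow> t' w = x \<cdot> t w \<cdot> winv x"
  shows "dual_basis k n t' a"
proof -
  have rayF: "ray k m \<in> F n" for m using replicate_F k by simp
  have tF: "t w \<in> F n" if "w \<in> F n" for w using auto_F_closed[OF t that] .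
  have aF: "a g \<in> F n" if "g \<in> F k" for g using F_mono[OF _ auto_F_closed[OF a that]] k by simp
  have red_x: "reduced_word x" using x by auto
  obtain m1 where m1: "\<And>m a. m \<ge> m1 \<Longrightarrow> a \<in> auto (free_group k) \<Longrightarrow>
    dual_walls k n (t \<circ> a) (t (ray k m)) \<Longrightarrow> dual_walls k n (t \<circ> a) (t (ray k m) \<cdot> winv x)"
    using dual_walls_shift[OF t k F_winv[OF x]] by blast
  have conj: "dual_walls k n (t' \<circ> a) (t' (ray k m))"
    if "dual_walls k n (t \<circ> a) (t (ray k m) \<cdot> winv x)" for m
    unfolding dual_walls_def
  proof (intro allI impI)
    fix c :: fletter assume "fst c < k"
    then obtain v l where v: "v \<in> F n"
      "\<forall>g\<in>F k. (t \<circ> a) g \<cdot> t (ray k m) \<cdot> winv x \<in> half_space v l \<longleftrightarrow> starts c g"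
      using \<open>dual_walls k n (t \<circ> a) (t (ray k m) \<cdot> winv x)\<close> unfolding dual_walls_def by blast
    have "(t' \<circ> a) g \<cdot> t' (ray k m) \<in> half_space (x \<cdot> v) l \<longleftrightarrow> starts c g" if g: "g \<in> F k" for g
    proof -
      have red: "reduced_word (t (a g))" "reduced_word (t (ray k m))" "reduced_word v"
        using tF rayF aF[OF g] v(1) by (blast intro: F_reduced)+
      have "(t' \<circ> a) g \<cdot> t' (ray k m) = x \<cdot> (t \<circ> a) g \<cdot> t (ray k m) \<cdot> winv x"
        using red red_x by (simp add: t' aF[OF g] rayF mult_assoc)
      then show ?thesis
        using half_space_translate[OF red_x red(3), of "x \<cdot> (t \<circ> a) g \<cdot> t (ray k m) \<cdot> winv x" l]
          v(2) g red_x by simp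
    qed
    then show "\<exists>v\<in>F n. \<exists>l. \<forall>g\<in>F k. (t' \<circ> a) g \<cdot> t' (ray k m) \<in> half_space v l \<longleftrightarrow> starts c g"
      using v(1) x by blast
  qed
  show ?thesis
    using dual eventually_ge_at_top[of m1] unfolding dual_basis_def
    by eventually_elim (use conj m1 a in blast)
qed

text \<open>
  If the marking agrees with \<open>a\<close> on the free factor and fixes the next basis element, the edges at the
  root are dual to \<open>a\<close>. This makes the construction a retraction.
\<close>

lemma dual_basis_standard:
  assumes k: "k < n" and a: "a \<in> auto (free_group k)" and t: "t \<in> auto (free_group n)"
    and ta: "\<And>g. g \<in> F k \<Longrightarrow> t (a g) = g" and tx: "t [(k, True)] = [(k, True)]"
  shows "dual_basis k n t a"
proof -
  have temb: "free_embedding n n t" by (rule auto_emb[OF t])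
  have rayF: "ray k m \<in> F n" for m using replicate_F k by simp
  have t_ray: "t (ray k m) = ray k m" for m
  proof (induction m)
    case (Suc m)
    then show ?case
      unfolding ray_Suc using free_embedding_mult[OF temb rayF, of "[(k, True)]" m] k tx by simp
  qed (simp add: free_embedding_Nil[OF temb])
  have "dual_walls k n (t \<circ> a) (t (ray k m))" for m
    unfolding dual_walls_def
  proof (intro allI impI)
    fix c :: fletter assume c: "fst c < k"
    have "(t \<circ> a) g \<cdot> t (ray k m) \<in> half_space [] c \<longleftrightarrow> starts c g" if "g \<in> F k" for g
    proof -
      have "(t \<circ> a) g \<cdot> t (ray k m) = g @ ray k m"
        by (simp only: comp_apply ta[OF that] t_ray mult_ray[OF that])
      then show ?thesis using c by (cases m) (auto simp: half_space_Nil)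
    qed
    then show "\<exists>v\<in>F n. \<exists>l. \<forall>g\<in>F k. (t \<circ> a) g \<cdot> t (ray k m) \<in> half_space v l \<longleftrightarrow> starts c g"
      by (intro bexI[of _ "[]"] exI[of _ c]) auto
  qed
  then show ?thesis by (simp add: dual_basis_def)
qed

lemma dual_basis_displacement:
  assumes t: "t \<in> auto (free_group n)" and k: "k < n"
  obtains K where "\<And>u a a' c. \<lbrakk>u \<in> auto (free_group n); a \<in> auto (free_group k); a' \<in> auto (free_group k);
      dual_basis k n u a; dual_basis k n (t \<circ> u) a'; fst c < k\<rbrakk> \<Longrightarrow>
    length ((inv\<^bsub>AutoGroup (free_group k)\<^esub> a \<otimes>\<^bsub>AutoGroup (free_group k)\<^esub> a') [c]) \<le> K"
proof -
  obtain K where K: "\<And>b s P c. \<lbrakk>free_embedding k n b; s \<in> auto (free_group k); P \<in> F n;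
    dual_walls k n b P; dual_walls k n (t \<circ> b \<circ> s) (t P); fst c < k\<rbrakk> \<Longrightarrow> length (s [c]) \<le> K"
    using dual_basis_change_bounded[OF t] by blast
  show ?thesis
  proof (rule that)
    fix u a a' and c :: fletter
    assume u: "u \<in> auto (free_group n)" and a: "a \<in> auto (free_group k)" and a': "a' \<in> auto (free_group k)"
      and dual: "dual_basis k n u a" "dual_basis k n (t \<circ> u) a'" and c: "fst c < k"
    let ?Q = "AutoGroup (free_group k)"
    let ?s = "inv\<^bsub>?Q\<^esub> a \<otimes>\<^bsub>?Q\<^esub> a'"
    have s: "?s \<in> auto (free_group k)" by (rule mult_AutF_auto[OF inv_AutF_auto[OF a] a'])
    have as: "a (?s g) = a' g" if "g \<in> F k" for g
      using that a a' by (simp add: mult_AutF_apply inv_AutF_auto inv_AutF_apply auto_F_closed)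
    have "\<forall>\<^sub>F m in sequentially. dual_walls k n (u \<circ> a) (u (ray k m)) \<and>
        dual_walls k n (t \<circ> u \<circ> a') ((t \<circ> u) (ray k m))"
      using dual unfolding dual_basis_def by (rule eventually_conj)
    then obtain m where m: "dual_walls k n (u \<circ> a) (u (ray k m))"
      "dual_walls k n (t \<circ> u \<circ> a') ((t \<circ> u) (ray k m))"
      using eventually_happens'[OF sequentially_bot] by blast
    have "dual_walls k n (t \<circ> (u \<circ> a) \<circ> ?s) (t (u (ray k m)))"
      using m(2) as dual_walls_cong[of k "t \<circ> (u \<circ> a) \<circ> ?s" "t \<circ> u \<circ> a'"] by simp
    moreover have "free_embedding k n (u \<circ> a)"
      using free_embedding_comp[OF auto_emb[OF a] free_embedding_subgroup[OF _ auto_emb[OF u]]] k by simp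
    moreover have "u (ray k m) \<in> F n" using auto_F_closed[OF u] replicate_F k by simp
    ultimately show "length (?s [c]) \<le> K" using K s m(1) c by blast
  qed
qed

section \<open>Lipschitz retractions from finite displacement\<close>

context group begin

lemma foldr_closed: "set ws \<subseteq> carrier G \<Longrightarrow> foldr (mult G) ws \<one> \<in> carrier G"
  by (induction ws) auto

lemma foldr_append_mult:
  "set us \<subseteq> carrier G \<Longrightarrow> set vs \<subseteq> carrier G \<Longrightarrow>
    foldr (mult G) (us @ vs) \<one> = foldr (mult G) us \<one> \<otimes> foldr (mult G) vs \<one>"
  using foldr_closed by (induction us) (auto simp: m_assoc)

lemma word_length_le:
  "set ws \<subseteq> S \<union> m_inv G ` S \<Longrightarrow> word_length G S (foldr (mult G) ws \<one>) \<le> length ws"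
  unfolding word_length_def by (rule Least_le) blast

lemma word_length_mult_le:
  assumes S: "finite_generating_set G S" and x: "x \<in> carrier G" and y: "y \<in> carrier G"
  shows "word_length G S (x \<otimes> y) \<le> word_length G S x + word_length G S y"
proof -
  obtain us where us: "length us = word_length G S x" "set us \<subseteq> S \<union> m_inv G ` S"
    "x = foldr (mult G) us \<one>" using word_length_attained[OF S x] by blast
  obtain vs where vs: "length vs = word_length G S y" "set vs \<subseteq> S \<union> m_inv G ` S"
    "y = foldr (mult G) vs \<one>" using word_length_attained[OF S y] by blast
  have sub: "S \<union> m_inv G ` S \<subseteq> carrier G" using S by (auto simp: finite_generating_set_def)
  have "x \<otimes> y = foldr (mult G) (us @ vs) \<one>"
    using foldr_append_mult[of us vs] us(2,3) vs(2,3) sub by (metis order_trans)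
  then show ?thesis using word_length_le[of "us @ vs" S] us vs by simp
qed

lemma word_dist_self: "x \<in> carrier G \<Longrightarrow> word_dist G S x x = 0"
  using word_length_le[of "[]" S] by (simp add: word_dist_def)

lemma word_dist_triangle:
  assumes S: "finite_generating_set G S"
    and x: "x \<in> carrier G" "y \<in> carrier G" "z \<in> carrier G"
  shows "word_dist G S x z \<le> word_dist G S x y + word_dist G S y z"
proof -
  have "inv x \<otimes> z = (inv x \<otimes> y) \<otimes> (inv y \<otimes> z)" using x by (simp add: m_assoc cancel)
  then show ?thesis
    using word_length_mult_le[OF S, of "inv x \<otimes> y" "inv y \<otimes> z"] x by (simp add: word_dist_def)
qed

end

text \<open>
  Along a word in the generators each step changes the value of \<open>p\<close> by an element of one finite set.
\<close>

lemma lipschitz_of_finite_displacement: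
  assumes G: "group G" and H: "group H" and p: "p \<in> carrier G \<rightarrow> carrier H"
    and disp: "\<And>s. s \<in> carrier G \<Longrightarrow>
      finite ((\<lambda>a. inv\<^bsub>H\<^esub> p a \<otimes>\<^bsub>H\<^esub> p (a \<otimes>\<^bsub>G\<^esub> s)) ` carrier G)"
    and S: "finite_generating_set G S" and T: "finite_generating_set H T"
  shows "\<exists>K::real. K \<ge> 1 \<and> (\<forall>a\<in>carrier G. \<forall>b\<in>carrier G.
    real (word_dist H T (p a) (p b)) \<le> K * real (word_dist G S a b))"
proof -
  interpret G: group G by fact
  interpret H: group H by fact
  let ?S = "S \<union> m_inv G ` S"
  have fin: "finite ?S" and sub: "?S \<subseteq> carrier G" using S by (auto simp: finite_generating_set_def)
  define D where "D = (\<Union>s\<in>?S. (\<lambda>a. inv\<^bsub>H\<^esub> p a \<otimes>\<^bsub>H\<^esub> p (a \<otimes>\<^bsub>G\<^esub> s)) ` carrier G)"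
  have fin_D: "finite D" unfolding D_def using fin sub disp by blast
  define K where "K = Suc (Max (insert 0 (word_length H T ` D)))"
  have step: "word_dist H T (p a) (p (a \<otimes>\<^bsub>G\<^esub> s)) \<le> K" if "a \<in> carrier G" "s \<in> ?S" for a s
  proof -
    have "inv\<^bsub>H\<^esub> p a \<otimes>\<^bsub>H\<^esub> p (a \<otimes>\<^bsub>G\<^esub> s) \<in> D" unfolding D_def using that by blast
    then have "word_dist H T (p a) (p (a \<otimes>\<^bsub>G\<^esub> s)) \<le> Max (insert 0 (word_length H T ` D))"
      unfolding word_dist_def using fin_D by (intro Max_ge) auto
    then show ?thesis by (simp add: K_def)
  qed
  have walk: "word_dist H T (p a) (p (a \<otimes>\<^bsub>G\<^esub> foldr (mult G) ws \<one>\<^bsub>G\<^esub>)) \<le> K * length ws"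
    if "set ws \<subseteq> ?S" "a \<in> carrier G" for ws a
    using that
  proof (induction ws arbitrary: a)
    case Nil
    then have "p a \<in> carrier H" using p by auto
    then show ?case using Nil H.word_dist_self by simp
  next
    case (Cons s ws)
    let ?r = "foldr (mult G) ws \<one>\<^bsub>G\<^esub>"
    have s: "s \<in> carrier G" and r: "?r \<in> carrier G" using Cons.prems sub G.foldr_closed[of ws] by auto
    have eq: "a \<otimes>\<^bsub>G\<^esub> foldr (mult G) (s # ws) \<one>\<^bsub>G\<^esub> = (a \<otimes>\<^bsub>G\<^esub> s) \<otimes>\<^bsub>G\<^esub> ?r"
      using s r Cons.prems by (simp add: G.m_assoc)
    have pc: "p x \<in> carrier H" if "x \<in> carrier G" for x using p that by auto
    have "word_dist H T (p a) (p ((a \<otimes>\<^bsub>G\<^esub> s) \<otimes>\<^bsub>G\<^esub> ?r)) \<le>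
        word_dist H T (p a) (p (a \<otimes>\<^bsub>G\<^esub> s)) +
        word_dist H T (p (a \<otimes>\<^bsub>G\<^esub> s)) (p ((a \<otimes>\<^bsub>G\<^esub> s) \<otimes>\<^bsub>G\<^esub> ?r))"
      using s r Cons.prems by (intro H.word_dist_triangle[OF T] pc) auto
    also have "\<dots> \<le> K + K * length ws"
      using step[of a s] Cons.IH[of "a \<otimes>\<^bsub>G\<^esub> s"] Cons.prems s by (intro add_mono) auto
    finally show ?case unfolding eq by simp
  qed
  have "word_dist H T (p a) (p b) \<le> K * word_dist G S a b"
    if ab: "a \<in> carrier G" "b \<in> carrier G" for a b
  proof -
    obtain ws where ws: "length ws = word_dist G S a b" "set ws \<subseteq> ?S"
      "inv\<^bsub>G\<^esub> a \<otimes>\<^bsub>G\<^esub> b = foldr (mult G) ws \<one>\<^bsub>G\<^esub>"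
      using G.word_length_attained[OF S, of "inv\<^bsub>G\<^esub> a \<otimes>\<^bsub>G\<^esub> b"] ab
      unfolding word_dist_def by auto
    have "a \<otimes>\<^bsub>G\<^esub> foldr (mult G) ws \<one>\<^bsub>G\<^esub> = b"
      unfolding ws(3)[symmetric] using ab by (simp add: G.cancel)
    then show ?thesis using walk[OF ws(2) ab(1)] ws(1) by simp
  qed
  then have "real (word_dist H T (p a) (p b)) \<le> real K * real (word_dist G S a b)"
    if "a \<in> carrier G" "b \<in> carrier G" for a b
    using that by (metis of_nat_le_iff of_nat_mult)
  then show ?thesis by (intro exI[of _ "real K"]) (auto simp: K_def)
qed

text \<open>
  The retraction is \<open>j \<circ> r\<close>. As \<open>j\<close> is an isomorphism onto its image, its
  displacement can be measured in \<open>Q\<close>.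
\<close>

theorem lipschitz_retraction_of_left_inverse:
  assumes G: "group G" "finitely_generated G" and Q: "group Q" "finitely_generated Q"
    and j: "j \<in> hom Q G" and r: "r \<in> carrier G \<rightarrow> carrier Q"
    and rj: "\<And>q. q \<in> carrier Q \<Longrightarrow> r (j q) = q"
    and disp: "\<And>s. s \<in> carrier G \<Longrightarrow>
      finite ((\<lambda>a. inv\<^bsub>Q\<^esub> r a \<otimes>\<^bsub>Q\<^esub> r (a \<otimes>\<^bsub>G\<^esub> s)) ` carrier G)"
  shows "\<exists>H p. lipschitz_retraction G H p \<and> G\<lparr>carrier := H\<rparr> \<cong> Q"
proof -
  interpret G: group G by fact
  interpret Q: group Q by fact
  interpret j: group_hom Q G j using j by unfold_locales
  define H where "H = j ` carrier Q"
  let ?H = "G\<lparr>carrier := H\<rparr>"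
  have H: "subgroup H G" unfolding H_def by (rule j.img_is_subgroup)
  interpret H: group ?H by (rule G.subgroup_imp_group[OF H])
  have jH: "j \<in> hom Q ?H" using j by (auto simp: hom_def H_def)
  interpret jH: group_hom Q ?H j using jH by unfold_locales
  obtain T where T: "finite_generating_set Q T" using Q(2) by (auto simp: finitely_generated_def)
  have "generate ?H (j ` T) = j ` generate Q T"
    using jH.generate_img[of T] T by (simp add: finite_generating_set_def)
  then have "finite_generating_set ?H (j ` T)"
    using T by (auto simp: finite_generating_set_def H_def)
  then have fgH: "finitely_generated ?H" by (auto simp: finitely_generated_def)
  have p: "j \<circ> r \<in> carrier G \<rightarrow> H" using r by (auto simp: H_def)
  have "\<exists>K::real. K \<ge> 1 \<and> (\<forall>a\<in>carrier G. \<forall>b\<in>carrier G.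
      real (word_dist ?H T' ((j \<circ> r) a) ((j \<circ> r) b)) \<le> K * real (word_dist G S a b))"
    if ST: "finite_generating_set G S" "finite_generating_set ?H T'" for S T'
  proof (rule lipschitz_of_finite_displacement[OF G(1) H.is_group _ _ ST])
    show "j \<circ> r \<in> carrier G \<rightarrow> carrier ?H" using p by simp
    fix s assume s: "s \<in> carrier G"
    have rc: "r a \<in> carrier Q" if "a \<in> carrier G" for a using r that by auto
    have "inv\<^bsub>?H\<^esub> (j \<circ> r) a \<otimes>\<^bsub>?H\<^esub> (j \<circ> r) (a \<otimes>\<^bsub>G\<^esub> s) =
        j (inv\<^bsub>Q\<^esub> r a \<otimes>\<^bsub>Q\<^esub> r (a \<otimes>\<^bsub>G\<^esub> s))" if a: "a \<in> carrier G" for a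
      using jH.hom_mult[of "inv\<^bsub>Q\<^esub> r a" "r (a \<otimes>\<^bsub>G\<^esub> s)"] jH.hom_inv[of "r a"] rc a s by simp
    then have "(\<lambda>a. inv\<^bsub>?H\<^esub> (j \<circ> r) a \<otimes>\<^bsub>?H\<^esub> (j \<circ> r) (a \<otimes>\<^bsub>G\<^esub> s)) ` carrier G =
        j ` (\<lambda>a. inv\<^bsub>Q\<^esub> r a \<otimes>\<^bsub>Q\<^esub> r (a \<otimes>\<^bsub>G\<^esub> s)) ` carrier G"
      unfolding image_image by (intro image_cong refl)
    then show "finite ((\<lambda>a. inv\<^bsub>?H\<^esub> (j \<circ> r) a \<otimes>\<^bsub>?H\<^esub> (j \<circ> r) (a \<otimes>\<^bsub>G\<^esub> s)) ` carrier G)"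
      using disp[OF s] by simp
  qed
  moreover have "\<forall>h\<in>H. (j \<circ> r) h = h" using rj by (auto simp: H_def)
  ultimately have "lipschitz_retraction G H (j \<circ> r)"
    unfolding lipschitz_retraction_def using G H fgH p by blast
  moreover have "?H \<cong> Q"
  proof -
    have "r \<in> hom ?H Q"
    proof (rule homI)
      fix x y assume "x \<in> carrier ?H" "y \<in> carrier ?H"
      then obtain p q where pq: "p \<in> carrier Q" "q \<in> carrier Q" "x = j p" "y = j q"
        by (auto simp: H_def)
      then show "r (x \<otimes>\<^bsub>?H\<^esub> y) = r x \<otimes>\<^bsub>Q\<^esub> r y"
        using rj[of p] rj[of q] rj[of "p \<otimes>\<^bsub>Q\<^esub> q"] by simp
    qed (use rj in \<open>auto simp: H_def\<close>)
    moreover have "bij_betw r H (carrier Q)"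
      by (rule bij_betw_byWitness[where f' = j]) (use rj in \<open>auto simp: H_def\<close>)
    ultimately have "r \<in> iso ?H Q" by (simp add: iso_def)
    then show ?thesis unfolding is_iso_def by blast
  qed
  ultimately show ?thesis by blast
qed


section \<open>Automorphisms of a free factor\<close>

definition extend_auto :: "nat \<Rightarrow> nat \<Rightarrow> (fletter list \<Rightarrow> fletter list) \<Rightarrow> fletter list \<Rightarrow> fletter list" where
  "extend_auto k n a = extend n n (\<lambda>i. if i < k then a [(i, True)] else [(i, True)])"

lemma extend_auto_hom:
  assumes "k \<le> n" "a \<in> auto (free_group k)"
  shows "extend_auto k n a \<in> hom (free_group n) (free_group n)"
  unfolding extend_auto_def
  by (rule extend_hom) (use assms F_mono[of k n] auto_F_closed[OF assms(2)] in auto)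

lemma extend_auto_letter:
  assumes "k \<le> n" "a \<in> auto (free_group k)" "i < n"
  shows "extend_auto k n a [(i, True)] = (if i < k then a [(i, True)] else [(i, True)])"
  unfolding extend_auto_def
  by (rule extend_letter) (use assms F_mono[of k n] auto_F_closed[OF assms(2)] in auto)

lemma extend_auto_apply:
  assumes k: "k \<le> n" and a: "a \<in> auto (free_group k)" and w: "w \<in> F k"
  shows "extend_auto k n a w = a w"
proof (rule hom_eq_on_F[OF _ _ _ w])
  show "extend_auto k n a \<in> hom (free_group k) (free_group n)"
    using extend_auto_hom[OF k a] F_mono[OF k] by (auto simp: hom_def)
  show "a \<in> hom (free_group k) (free_group n)"
    using a F_mono[OF k] by (auto simp: auto_def hom_def)
  show "extend_auto k n a [(i, True)] = a [(i, True)]" if "i < k" for i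
    using extend_auto_letter[OF k a, of i] that k by simp
qed

lemma extend_auto_auto:
  assumes k: "k \<le> n" and a: "a \<in> auto (free_group k)"
  shows "extend_auto k n a \<in> auto (free_group n)"
proof (rule auto_FI)
  let ?i = "inv\<^bsub>AutoGroup (free_group k)\<^esub> a"
  have i: "?i \<in> auto (free_group k)" by (rule inv_AutF_auto[OF a])
  show "extend_auto k n a \<in> hom (free_group n) (free_group n)"
    "extend_auto k n ?i \<in> hom (free_group n) (free_group n)"
    using extend_auto_hom k a i by blast+
  show "extend_auto k n a \<in> extensional (F n)" by (simp add: extend_auto_def extend_extensional)
  show "extend_auto k n a (extend_auto k n ?i [(j, True)]) = [(j, True)]" if j: "j < n" for j
    using extend_auto_letter[OF k i j] extend_auto_letter[OF k a j]
      extend_auto_apply[OF k a auto_F_closed[OF i, of "[(j, True)]"]] inv_AutF_apply(2)[OF a, of "[(j, True)]"]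
    by (auto split: if_splits)
  show "extend_auto k n ?i (extend_auto k n a [(j, True)]) = [(j, True)]" if j: "j < n" for j
    using extend_auto_letter[OF k i j] extend_auto_letter[OF k a j]
      extend_auto_apply[OF k i auto_F_closed[OF a, of "[(j, True)]"]] inv_AutF_apply(1)[OF a, of "[(j, True)]"]
    by (auto split: if_splits)
qed

lemma extend_auto_group_hom:
  assumes k: "k \<le> n"
  shows "extend_auto k n \<in> hom (AutoGroup (free_group k)) (AutoGroup (free_group n))"
proof (rule homI)
  fix a b assume "a \<in> carrier (AutoGroup (free_group k))" "b \<in> carrier (AutoGroup (free_group k))"
  then have a: "a \<in> auto (free_group k)" and b: "b \<in> auto (free_group k)" by simp_all
  let ?ab = "a \<otimes>\<^bsub>AutoGroup (free_group k)\<^esub> b"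
  have ab: "?ab \<in> auto (free_group k)" by (rule mult_AutF_auto[OF a b])
  note ea = extend_auto_auto[OF k a] and eb = extend_auto_auto[OF k b]
  show "extend_auto k n ?ab = extend_auto k n a \<otimes>\<^bsub>AutoGroup (free_group n)\<^esub> extend_auto k n b"
  proof (rule auto_F_eqI[OF extend_auto_auto[OF k ab] mult_AutF_auto[OF ea eb]])
    fix i assume i: "i < n"
    show "extend_auto k n ?ab [(i, True)] =
        (extend_auto k n a \<otimes>\<^bsub>AutoGroup (free_group n)\<^esub> extend_auto k n b) [(i, True)]"
      using extend_auto_letter[OF k ab i] extend_auto_letter[OF k a i] extend_auto_letter[OF k b i]
        extend_auto_apply[OF k a auto_F_closed[OF b, of "[(i, True)]"]]
        mult_AutF_apply[OF a b, of "[(i, True)]"] mult_AutF_apply[OF ea eb, of "[(i, True)]"] i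
      by (auto split: if_splits)
  qed
qed (simp add: extend_auto_auto[OF k])

text \<open>
  A weak form of the fact that the centralizer of a letter consists of its powers.
\<close>

lemma commutes_with_letter:
  "w \<in> F n \<Longrightarrow> w \<cdot> [a] = [a] \<cdot> w \<Longrightarrow> fst ` set w \<subseteq> {fst a}"
proof (induction w)
  case (Cons b w)
  have w: "w \<in> F n" using Cons.prems(1) by (simp add: F_Cons)
  have red: "reduced_word (b # w)" "reduced_word w"
    using F_reduced[OF Cons.prems(1)] F_reduced[OF w] .
  have bw: "b # w = [b] \<cdot> w" using mult_append[of "[b]" w] red by simp
  show ?case
  proof (cases "fst b = fst a")
    case True
    have ba: "[b] \<cdot> [a] = [a] \<cdot> [b]"
      using True letter_cases[of b a] by (auto simp: pair_letter)
    have "[b] \<cdot> (w \<cdot> [a]) = ([b] \<cdot> w) \<cdot> [a]" by (simp add: mult_assoc)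
    also have "\<dots> = [a] \<cdot> [b] \<cdot> w" using Cons.prems(2) by (simp add: bw)
    also have "\<dots> = ([a] \<cdot> [b]) \<cdot> w" using red by (simp add: mult_assoc)
    also have "\<dots> = [b] \<cdot> ([a] \<cdot> w)" using red by (simp add: ba[symmetric] mult_assoc)
    finally have "w \<cdot> [a] = [a] \<cdot> w" using red by simp
    then show ?thesis using Cons.IH[OF w] True by simp
  next
    case False
    then have "[a] \<cdot> (b # w) = a # b # w" using letter_cases[of b a] by (auto simp: wmult_def)
    then have eq: "(b # w) \<cdot> [a] = a # b # w" using Cons.prems(2) by simp
    show ?thesis
    proof (cases rule: mult_letter_cases[OF red(1), of a])
      case (1 w')
      then have "length (b # w) = Suc (length (a # b # w))" using eq by (metis length_append_singleton)
      then show ?thesis by simp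
    next
      case 2
      then have "a = b" using eq by simp
      then show ?thesis using False by simp
    qed
  qed
qed simp

text \<open>
  The conjugating element \<open>x\<close> commutes with the basis element \<open>(k, True)\<close>, hence is a
  power of it. It also takes a basis element of the free factor into the free factor, so it is trivial.
\<close>

lemma extend_auto_inj_mod_inner:
  assumes k: "0 < k" "k < n" and a: "a \<in> auto (free_group k)" and b: "b \<in> auto (free_group k)"
    and x: "x \<in> F n" and conj: "\<And>w. w \<in> F n \<Longrightarrow> extend_auto k n a w = x \<cdot> extend_auto k n b w \<cdot> winv x"
  shows "a = b"
proof -
  have red_x: "reduced_word x" using x by auto
  have le: "k \<le> n" using k by simp
  have "[(k, True)] = x \<cdot> [(k, True)] \<cdot> winv x"
    using conj[of "[(k, True)]"] k extend_auto_letter[OF le a, of k] extend_auto_letter[OF le b, of k] by simp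
  then have "[(k, True)] \<cdot> x = (x \<cdot> [(k, True)] \<cdot> winv x) \<cdot> x" by simp
  also have "\<dots> = x \<cdot> [(k, True)]" using red_x by (simp add: mult_assoc)
  finally have letters: "fst ` set x \<subseteq> {k}" using commutes_with_letter[OF x, of "(k, True)"] by simp
  obtain w where w: "w \<in> F k" "b w = [(0, True)]"
  proof
    show "(inv\<^bsub>AutoGroup (free_group k)\<^esub> b) [(0, True)] \<in> F k"
      using auto_F_closed[OF inv_AutF_auto[OF b]] k by simp
    show "b ((inv\<^bsub>AutoGroup (free_group k)\<^esub> b) [(0, True)]) = [(0, True)]"
      using inv_AutF_apply(2)[OF b] k by simp
  qed
  have "a w = x \<cdot> [(0, True)] \<cdot> winv x"
    using conj[OF F_mono[OF le w(1)]] extend_auto_apply[OF le a w(1)] extend_auto_apply[OF le b w(1)] w(2) by simp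
  also have "\<dots> = x @ [(0, True)] @ winv x"
  proof -
    have "fst (last x) = k" if "x \<noteq> []" using letters last_in_set[OF that] by auto
    then have "(0, True) \<noteq> flip (last x)" "flip (last x) \<noteq> flip (0, True)" if "x \<noteq> []"
      using that k by (auto simp: flip_def)
    moreover have "hd (winv x) = flip (last x)" if "x \<noteq> []"
      using that by (simp add: winv_def hd_rev last_map)
    ultimately have "reduced_word (x @ [(0, True)] @ winv x)"
      unfolding reduced_append using red_x by auto
    moreover have "reduced_word ([(0, True)] @ winv x)" using calculation reduced_append by blast
    ultimately show ?thesis using mult_append by metis
  qed
  finally have "fst ` set x \<subseteq> {..<k}" using auto_F_closed[OF a w(1)] by (auto simp: F_iff)
  then have "x = []" using letters by (cases x) auto
  show "a = b"
  proof (rule auto_F_eqI[OF a b])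
    fix i assume i: "i < k"
    then have "[(i, True)] \<in> F n" using k by simp
    then have "extend_auto k n a [(i, True)] = extend_auto k n b [(i, True)]"
      using conj[of "[(i, True)]"] \<open>x = []\<close> auto_F_closed[OF extend_auto_auto[OF le b], of "[(i, True)]"]
      by (auto dest!: F_reduced)
    then show "a [(i, True)] = b [(i, True)]"
      using extend_auto_letter[OF le a] extend_auto_letter[OF le b] i k by simp
  qed
qed

section \<open>Retracting outer automorphisms onto automorphisms of a free factor\<close>

interpretation OutF: group "OutGroup (free_group n)" for n
  by (rule FG.group_OutGroup)

abbreviation out_class :: "nat \<Rightarrow> (fletter list \<Rightarrow> fletter list) \<Rightarrow> (fletter list \<Rightarrow> fletter list) set" where
  "out_class n a \<equiv> Inn (free_group n) #>\<^bsub>AutoGroup (free_group n)\<^esub> a"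

lemma out_class_hom:
  "out_class n \<in> hom (AutoGroup (free_group n)) (OutGroup (free_group n))"
  unfolding OutGroup_def by (rule normal.r_coset_hom_Mod[OF FG.Inn_normal])

lemma carrier_OutF: "carrier (OutGroup (free_group n)) = out_class n ` auto (free_group n)"
  by (auto simp: OutGroup_def FactGroup_def RCOSETS_def)

lemma OutF_finitely_generated: "finitely_generated (OutGroup (free_group n))"
proof -
  interpret h: group_hom "AutoGroup (free_group n)" "OutGroup (free_group n)" "out_class n"
    using out_class_hom by unfold_locales
  have "finite_generating_set (OutGroup (free_group n)) (out_class n ` short_autos n)"
    using AutF_finite_generating_set[of n] h.generate_img[of "short_autos n"]
    by (auto simp: finite_generating_set_def carrier_OutF)
  then show ?thesis by (auto simp: finitely_generated_def)
qed

lemma out_class_eqE: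
  assumes a: "a \<in> auto (free_group n)" and b: "b \<in> auto (free_group n)" and eq: "out_class n a = out_class n b"
  obtains x where "x \<in> F n" "\<And>w. w \<in> F n \<Longrightarrow> a w = x \<cdot> b w \<cdot> winv x"
proof -
  interpret N: normal "Inn (free_group n)" "AutoGroup (free_group n)" by (rule FG.Inn_normal)
  have "a \<in> out_class n b"
    unfolding eq[symmetric] using AutF.rcos_self[OF _ N.subgroup_axioms, of a] a by simp
  then obtain c where "c \<in> Inn (free_group n)" "a = c \<otimes>\<^bsub>AutoGroup (free_group n)\<^esub> b"
    unfolding r_coset_def by blast
  moreover from this obtain x where x: "x \<in> F n"
    and c: "c = (\<lambda>w \<in> F n. x \<otimes>\<^bsub>free_group n\<^esub> w \<otimes>\<^bsub>free_group n\<^esub> inv\<^bsub>free_group n\<^esub> x)"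
    by (auto simp: Inn_def)
  moreover have "c \<in> auto (free_group n)" unfolding c by (rule FG.conj_in_auto[OF x])
  ultimately have "a w = x \<cdot> b w \<cdot> winv x" if w: "w \<in> F n" for w
    using mult_AutF_apply[of c n b w] b w auto_F_closed[OF b w] F_reduced[OF F_winv[OF x]]
    by (simp add: mult_assoc)
  then show ?thesis using that x by blast
qed

text \<open>
  By invariance under conjugation it makes no difference whether one or all representatives of the class are asked
  to have the dual basis.
\<close>

definition dual_of_class :: "nat \<Rightarrow> nat \<Rightarrow> (fletter list \<Rightarrow> fletter list) set \<Rightarrow> (fletter list \<Rightarrow> fletter list) \<Rightarrow> bool" where
  "dual_of_class k n C b \<longleftrightarrow> b \<in> auto (free_group k) \<and>
    (\<forall>a\<in>auto (free_group n). out_class n a = C \<longrightarrow>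
      dual_basis k n (inv\<^bsub>AutoGroup (free_group n)\<^esub> a) b)"

lemma dual_of_classI:
  assumes k: "k < n" and a: "a \<in> auto (free_group n)" and b: "b \<in> auto (free_group k)"
    and dual: "dual_basis k n (inv\<^bsub>AutoGroup (free_group n)\<^esub> a) b"
  shows "dual_of_class k n (out_class n a) b"
  unfolding dual_of_class_def
proof (intro conjI ballI impI)
  fix a' assume a': "a' \<in> auto (free_group n)" and eq: "out_class n a' = out_class n a"
  let ?i = "inv\<^bsub>AutoGroup (free_group n)\<^esub> a" and ?i' = "inv\<^bsub>AutoGroup (free_group n)\<^esub> a'"
  have i: "?i \<in> auto (free_group n)" and i': "?i' \<in> auto (free_group n)"
    using inv_AutF_auto a a' by blast+
  obtain x where x: "x \<in> F n" "\<And>w. w \<in> F n \<Longrightarrow> a w = x \<cdot> a' w \<cdot> winv x"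
    using out_class_eqE[OF a a' eq[symmetric]] by blast
  note emb = auto_emb[OF i]
  have "?i' w = ?i x \<cdot> ?i w \<cdot> winv (?i x)" if w: "w \<in> F n" for w
  proof -
    have i'w: "?i' w \<in> F n" by (rule auto_F_closed[OF i' w])
    have "a (?i' w) = x \<cdot> w \<cdot> winv x" using x(2)[OF i'w] inv_AutF_apply(2)[OF a' w] by simp
    then have "?i' w = ?i (x \<cdot> w \<cdot> winv x)" using inv_AutF_apply(1)[OF a i'w] by simp
    then show ?thesis using x(1) w by (simp add: free_embedding_mult[OF emb] free_embedding_winv[OF emb])
  qed
  then show "dual_basis k n ?i' b"
    using dual_basis_conj[OF i k auto_F_closed[OF i x(1)] b dual] by blast
qed (fact b)

lemma dual_of_class_exists:
  assumes k: "k < n" and C: "C \<in> carrier (OutGroup (free_group n))"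
  shows "\<exists>b. dual_of_class k n C b"
proof -
  obtain a where a: "a \<in> auto (free_group n)" "C = out_class n a" using C by (auto simp: carrier_OutF)
  then show ?thesis
    using dual_basis_exists[OF inv_AutF_auto[OF a(1)] k] dual_of_classI[OF k a(1)] by metis
qed

lemma dual_of_class_extend_auto:
  assumes k: "k < n" and b: "b \<in> auto (free_group k)"
  shows "dual_of_class k n (out_class n (extend_auto k n b)) b"
proof (rule dual_of_classI[OF k _ b])
  have le: "k \<le> n" using k by simp
  show e: "extend_auto k n b \<in> auto (free_group n)" by (rule extend_auto_auto[OF le b])
  let ?i = "inv\<^bsub>AutoGroup (free_group n)\<^esub> extend_auto k n b"
  show "dual_basis k n ?i b"
  proof (rule dual_basis_standard[OF k b inv_AutF_auto[OF e]])
    fix g assume g: "g \<in> F k"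
    then show "?i (b g) = g"
      using inv_AutF_apply(1)[OF e F_mono[OF le g]] extend_auto_apply[OF le b g] by simp
  next
    show "?i [(k, True)] = [(k, True)]"
      using inv_AutF_apply(1)[OF e, of "[(k, True)]"] extend_auto_letter[OF le b, of k] k by simp
  qed
qed

lemma dual_of_class_finite_displacement:
  assumes k: "k < n" and S: "S \<in> carrier (OutGroup (free_group n))"
    and r: "\<And>C. C \<in> carrier (OutGroup (free_group n)) \<Longrightarrow> dual_of_class k n C (r C)"
  shows "finite ((\<lambda>C. inv\<^bsub>AutoGroup (free_group k)\<^esub> r C \<otimes>\<^bsub>AutoGroup (free_group k)\<^esub>
    r (C \<otimes>\<^bsub>OutGroup (free_group n)\<^esub> S)) ` carrier (OutGroup (free_group n)))"
    (is "finite (?d ` _)")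
proof -
  let ?A = "AutoGroup (free_group n)"
  obtain s where s: "s \<in> auto (free_group n)" "S = out_class n s" using S by (auto simp: carrier_OutF)
  have s_inv: "inv\<^bsub>?A\<^esub> s \<in> auto (free_group n)" by (rule inv_AutF_auto[OF s(1)])
  obtain K where K: "\<And>u a a' c. \<lbrakk>u \<in> auto (free_group n); a \<in> auto (free_group k); a' \<in> auto (free_group k);
      dual_basis k n u a; dual_basis k n (inv\<^bsub>?A\<^esub> s \<circ> u) a'; fst c < k\<rbrakk> \<Longrightarrow>
    length ((inv\<^bsub>AutoGroup (free_group k)\<^esub> a \<otimes>\<^bsub>AutoGroup (free_group k)\<^esub> a') [c]) \<le> K"
    using dual_basis_displacement[OF s_inv k] by blast
  have "?d C \<in> {b \<in> auto (free_group k). \<forall>i<k. length (b [(i, True)]) \<le> K}"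
    if C: "C \<in> carrier (OutGroup (free_group n))" for C
  proof -
    obtain a where a: "a \<in> auto (free_group n)" "C = out_class n a" using C by (auto simp: carrier_OutF)
    let ?as = "a \<otimes>\<^bsub>?A\<^esub> s" and ?CS = "C \<otimes>\<^bsub>OutGroup (free_group n)\<^esub> S"
    have as: "?as \<in> auto (free_group n)" by (rule mult_AutF_auto[OF a(1) s(1)])
    have CS: "?CS = out_class n ?as" using hom_mult[OF out_class_hom, of a n s] a s by simp
    then have CS_carrier: "?CS \<in> carrier (OutGroup (free_group n))" using as by (simp add: carrier_OutF)
    note ia = inv_AutF_auto[OF a(1)]
    have dual: "dual_basis k n (inv\<^bsub>?A\<^esub> a) (r C)" and rC: "r C \<in> auto (free_group k)"
      using r[OF C] a by (simp_all add: dual_of_class_def)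
    have dual': "dual_basis k n (inv\<^bsub>?A\<^esub> ?as) (r ?CS)" and rCS: "r ?CS \<in> auto (free_group k)"
      using r[OF CS_carrier] as CS by (simp_all add: dual_of_class_def)
    have inv_eq: "inv\<^bsub>?A\<^esub> ?as = inv\<^bsub>?A\<^esub> s \<otimes>\<^bsub>?A\<^esub> inv\<^bsub>?A\<^esub> a"
      using AutF.inv_mult_group[of a n s] a s by simp
    have "(inv\<^bsub>?A\<^esub> s \<circ> inv\<^bsub>?A\<^esub> a) w = [] \<cdot> (inv\<^bsub>?A\<^esub> ?as) w \<cdot> winv []" if w: "w \<in> F n" for w
      using mult_AutF_apply[OF s_inv ia w] F_reduced[OF auto_F_closed[OF inv_AutF_auto[OF as] w]]
      by (simp add: inv_eq)
    then have "dual_basis k n (inv\<^bsub>?A\<^esub> s \<circ> inv\<^bsub>?A\<^esub> a) (r ?CS)"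
      using dual_basis_conj[OF inv_AutF_auto[OF as] k _ rCS dual', of "[]"] by simp
    then have "length (?d C [(i, True)]) \<le> K" if "i < k" for i
      using K[OF ia rC rCS dual, of "(i, True)"] that by simp
    then show ?thesis using mult_AutF_auto[OF inv_AutF_auto[OF rC] rCS] by simp
  qed
  then have "?d ` carrier (OutGroup (free_group n)) \<subseteq>
      {b \<in> auto (free_group k). \<forall>i<k. length (b [(i, True)]) \<le> K}" by blast
  then show ?thesis by (rule finite_subset[OF _ finite_bounded_autos])
qed

text \<open>
  A dual basis is not unique. On the classes of extended automorphisms the value of the retraction is therefore
  prescribed; elsewhere any choice will do, since the displacement bound holds for all choices.
\<close>

theorem lipschitz_retractions_onto_Aut_free_factor:
  assumes k: "0 < k" "k < n"
  shows "\<exists>H p. lipschitz_retraction (OutGroup (free_group n)) H p \<and>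
      (OutGroup (free_group n))\<lparr>carrier := H\<rparr> \<cong> AutoGroup (free_group k)"
    and "\<exists>H p. lipschitz_retraction (AutoGroup (free_group n)) H p \<and>
      (AutoGroup (free_group n))\<lparr>carrier := H\<rparr> \<cong> AutoGroup (free_group k)"
proof -
  let ?A = "AutoGroup (free_group n)" and ?O = "OutGroup (free_group n)" and ?Q = "AutoGroup (free_group k)"
  let ?j = "extend_auto k n"
  have le: "k \<le> n" using k by simp
  have j: "?j \<in> hom ?Q ?A" by (rule extend_auto_group_hom[OF le])
  have ja: "?j b \<in> auto (free_group n)" if "b \<in> auto (free_group k)" for b
    by (rule extend_auto_auto[OF le that])
  have "\<exists>b. dual_of_class k n C b \<and>
      (\<forall>b'\<in>auto (free_group k). C = out_class n (?j b') \<longrightarrow> b = b')" if C: "C \<in> carrier ?O" for C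
  proof (cases "\<exists>b\<in>auto (free_group k). C = out_class n (?j b)")
    case True
    then obtain b where b: "b \<in> auto (free_group k)" "C = out_class n (?j b)" by blast
    have "b = b'" if b': "b' \<in> auto (free_group k)" "C = out_class n (?j b')" for b'
    proof -
      have "out_class n (?j b) = out_class n (?j b')" using b b' by simp
      then obtain x where "x \<in> F n" "\<And>w. w \<in> F n \<Longrightarrow> ?j b w = x \<cdot> ?j b' w \<cdot> winv x"
        using out_class_eqE[OF ja[OF b(1)] ja[OF b'(1)]] by blast
      then show ?thesis by (rule extend_auto_inj_mod_inner[OF k b(1) b'(1)])
    qed
    then show ?thesis using dual_of_class_extend_auto[OF k(2) b(1)] b(2) by blast
  next
    case False
    then show ?thesis using dual_of_class_exists[OF k(2) C] by blast
  qed
  then obtain r where r: "\<And>C. C \<in> carrier ?O \<Longrightarrow> dual_of_class k n C (r C)"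
    and rj: "\<And>C b. C \<in> carrier ?O \<Longrightarrow> b \<in> auto (free_group k) \<Longrightarrow> C = out_class n (?j b) \<Longrightarrow> r C = b"
    by metis
  have disp: "finite ((\<lambda>C. inv\<^bsub>?Q\<^esub> r C \<otimes>\<^bsub>?Q\<^esub> r (C \<otimes>\<^bsub>?O\<^esub> S)) ` carrier ?O)"
    if "S \<in> carrier ?O" for S
    by (rule dual_of_class_finite_displacement[OF k(2) that r])
  have fgA: "finitely_generated (AutoGroup (free_group m))" for m
    using AutF_finite_generating_set by (auto simp: finitely_generated_def)
  have rC: "r C \<in> carrier ?Q" if "C \<in> carrier ?O" for C
    using r[OF that] by (simp add: dual_of_class_def)
  have cls: "out_class n a \<in> carrier ?O" if "a \<in> auto (free_group n)" for a
    using that by (simp add: carrier_OutF)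
  show "\<exists>H p. lipschitz_retraction ?O H p \<and> ?O\<lparr>carrier := H\<rparr> \<cong> ?Q"
  proof (rule lipschitz_retraction_of_left_inverse[OF FG.group_OutGroup OutF_finitely_generated
      AutF.is_group fgA hom_compose[OF j out_class_hom] _ _ disp])
    show "r \<in> carrier ?O \<rightarrow> carrier ?Q" using rC by blast
    show "r ((out_class n \<circ> ?j) b) = b" if "b \<in> carrier ?Q" for b
      using rj[OF cls[OF ja] _ refl] that by simp
  qed
  show "\<exists>H p. lipschitz_retraction ?A H p \<and> ?A\<lparr>carrier := H\<rparr> \<cong> ?Q"
  proof (rule lipschitz_retraction_of_left_inverse[OF AutF.is_group fgA AutF.is_group fgA j])
    show "r \<circ> out_class n \<in> carrier ?A \<rightarrow> carrier ?Q" using rC cls by simp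
    show "(r \<circ> out_class n) (?j b) = b" if "b \<in> carrier ?Q" for b
      using rj[OF cls[OF ja] _ refl] that by simp
    fix s assume s: "s \<in> carrier ?A"
    have "(\<lambda>a. inv\<^bsub>?Q\<^esub> (r \<circ> out_class n) a \<otimes>\<^bsub>?Q\<^esub> (r \<circ> out_class n) (a \<otimes>\<^bsub>?A\<^esub> s)) ` carrier ?A
      \<subseteq> (\<lambda>C. inv\<^bsub>?Q\<^esub> r C \<otimes>\<^bsub>?Q\<^esub> r (C \<otimes>\<^bsub>?O\<^esub> out_class n s)) ` carrier ?O"
    proof (rule image_subsetI)
      fix a assume a: "a \<in> carrier ?A"
      have "out_class n (a \<otimes>\<^bsub>?A\<^esub> s) = out_class n a \<otimes>\<^bsub>?O\<^esub> out_class n s"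
        by (rule hom_mult[OF out_class_hom a s])
      then show "inv\<^bsub>?Q\<^esub> (r \<circ> out_class n) a \<otimes>\<^bsub>?Q\<^esub> (r \<circ> out_class n) (a \<otimes>\<^bsub>?A\<^esub> s)
        \<in> (\<lambda>C. inv\<^bsub>?Q\<^esub> r C \<otimes>\<^bsub>?Q\<^esub> r (C \<otimes>\<^bsub>?O\<^esub> out_class n s)) ` carrier ?O"
        using cls[of a] a by (intro image_eqI[of _ _ "out_class n a"]) simp_all
    qed
    then show "finite ((\<lambda>a. inv\<^bsub>?Q\<^esub> (r \<circ> out_class n) a \<otimes>\<^bsub>?Q\<^esub>
        (r \<circ> out_class n) (a \<otimes>\<^bsub>?A\<^esub> s)) ` carrier ?A)"
      using disp[OF cls, of s] s by (auto elim: finite_subset)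
  qed
qed

theorem corollary4:
  fixes n :: nat
  assumes "n \<ge> 4"
  shows "(\<exists>H \<pi>. lipschitz_retraction (OutGroup (free_group n)) H \<pi> \<and>
                (OutGroup (free_group n))\<lparr>carrier := H\<rparr> \<cong> AutoGroup (free_group 3))
       \<and> (\<exists>H \<pi>. lipschitz_retraction (AutoGroup (free_group n)) H \<pi> \<and>
                (AutoGroup (free_group n))\<lparr>carrier := H\<rparr> \<cong> AutoGroup (free_group 3))"
  using lipschitz_retractions_onto_Aut_free_factor[of 3 n] assms by simp

end
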